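(* Let $\varepsilon>0$. Let $v,u\in C^\infty(\mathbb{R})$ with $v$ supported in $[1,2^{3/2}]$ and $u$ even and supported in $[-1,1]$, and assume $u^{(j)}(0)=v^{(j)}(2)=0$ for all $j=0,1,2,\dots$. For $Q\ge1$ set $u_Q(y)=Q^{\varepsilon/2}u(Q^{\varepsilon}y)$ and define $$F_\varepsilon(s)=\sum_{Q\in\mathrm{Sq}_{\mathrm{odd}}}Q^{-s}\big(v\,\big|\,\Psi(Q^{2i\pi\mathcal{E}}\mathfrak{T}_{\frac{\infty}{2}})\,u_Q\big),\qquad F_0(s)=\sum_{Q\in\mathrm{Sq}_{\mathrm{odd}}}Q^{-s}\big(v\,\big|\,\Psi(Q^{2i\pi\mathcal{E}}\mathfrak{T}_{\frac{\infty}{2}})\,u\big).$$ Then $F_\varepsilon$ is an entire function of $s$, and for $\Re s>2$, $F_\varepsilon(s)\to F_0(s)$ as $\varepsilon\to0$.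
   Context: $\mathrm{Sq}_{\mathrm{odd}}$ is the set of positive squarefree odd integers. For $\mathfrak{S}\in\mathcal{S}'(\mathbb{R}^2)$, $\Psi(\mathfrak{S})$ is the operator weakly defined by $(\Psi(\mathfrak{S})u)(x)=\frac12\int_{\mathbb{R}^2}\mathfrak{S}(\frac{x+y}{2},\xi)e^{i\pi(x-y)\xi}u(y)\,dy\,d\xi$, and $(v|w)=\int_{\mathbb{R}}\overline{v}w$. For $Q>0$, $(Q^{2i\pi\mathcal{E}}\mathfrak{S})(x,\xi)=Q\,\mathfrak{S}(Qx,Q\xi)$. With $a'(r)=\prod_{p\text{ odd prime},\,p|r}(1-p)$, $\mathfrak{T}_{\frac{\infty}{2}}(x,\xi)=\sum_{(j,k)\in\mathbb{Z}^2\setminus\{0\}}a'(\gcd(j,k))\delta(x-j)\delta(\xi-k)$. *)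

theory Defs
  imports
    "HOL-Complex_Analysis.Complex_Analysis"
    "HOL-Computational_Algebra.Computational_Algebra"
begin

definition vderiv :: "nat \<Rightarrow> (real \<Rightarrow> complex) \<Rightarrow> real \<Rightarrow> complex" where
  "vderiv j f = ((\<lambda>g x. vector_derivative g (at x)) ^^ j) f"

definition smooth :: "(real \<Rightarrow> complex) \<Rightarrow> bool" where
  "smooth f \<longleftrightarrow> (\<forall>j x. vderiv j f differentiable (at x))"

definition supp :: "(real \<Rightarrow> complex) \<Rightarrow> real set" where
  "supp f = closure {x. f x \<noteq> 0}"

text \<open>
  Distributions on the line and on the plane are functionals on test functions, under the
  bilinear pairing that extends integration of the product (no complex conjugation).
  Only values on Schwartz functions are meaningful.
\<close>

type_synonym distr1 = "(real \<Rightarrow> complex) \<Rightarrow> complex"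
type_synonym distr2 = "(real \<times> real \<Rightarrow> complex) \<Rightarrow> complex"

text \<open>
  The sesquilinear pairing (v | D), antilinear in v: for a function D it is the integral of
  the product of the conjugate of v with D.
\<close>

definition sesq :: "(real \<Rightarrow> complex) \<Rightarrow> distr1 \<Rightarrow> complex" where
  "sesq v D = D (\<lambda>x. cnj (v x))"

text \<open>
  The Weyl operator with symbol S. Testing
  (1/2) \<integral> S((x+y)/2, \<xi>) exp(i \<pi> (x-y) \<xi>) u(y) dy d\<xi>
  against w(x) and substituting x = X + t, y = X - t, where dx dy = 2 dX dt, the factor 1/2
  cancels and one gets the pairing of S with the function of (X, \<xi>) below.
  It is a Schwartz function as soon as u and w are.
\<close>

definition wigner :: "(real \<Rightarrow> complex) \<Rightarrow> (real \<Rightarrow> complex) \<Rightarrow> real \<times> real \<Rightarrow> complex" where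
  "wigner w u = (\<lambda>(X, \<xi>). LBINT t. w (X + t) * cis (2 * pi * t * \<xi>) * u (X - t))"

definition Psi :: "distr2 \<Rightarrow> (real \<Rightarrow> complex) \<Rightarrow> distr1" where
  "Psi S u = (\<lambda>w. S (wigner w u))"

text \<open>
  The map taking S to Q S(Q x, Q \<xi>), for Q > 0, transposed to test functions: the Jacobian
  of the substitution contributes the inverse square of Q.
\<close>

definition dilate :: "real \<Rightarrow> distr2 \<Rightarrow> distr2" where
  "dilate Q S = (\<lambda>\<phi>. of_real (1 / Q) * S (\<lambda>(x, \<xi>). \<phi> (x / Q, \<xi> / Q)))"

definition a' :: "int \<Rightarrow> int" where
  "a' r = (\<Prod>p | prime p \<and> odd p \<and> p dvd r. 1 - p)"

definition T_inf_half :: distr2 where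
  "T_inf_half = (\<lambda>\<phi>. \<Sum>\<^sub>\<infinity>(j, k)\<in>UNIV - {(0, 0)}.
     of_int (a' (gcd j k)) * \<phi> (real_of_int j, real_of_int k))"

definition Sq_odd :: "nat set" where
  "Sq_odd = {Q. Q > 0 \<and> squarefree Q \<and> odd Q}"

definition rescale :: "real \<Rightarrow> (real \<Rightarrow> complex) \<Rightarrow> nat \<Rightarrow> real \<Rightarrow> complex" where
  "rescale \<epsilon> u Q = (\<lambda>y. of_real (real Q powr (\<epsilon> / 2)) * u (real Q powr \<epsilon> * y))"

definition F_term :: "(real \<Rightarrow> complex) \<Rightarrow> (nat \<Rightarrow> real \<Rightarrow> complex) \<Rightarrow> complex \<Rightarrow> nat \<Rightarrow> complex" where
  "F_term v w s Q =
     of_nat Q powr (- s) * sesq v (Psi (dilate (real Q) T_inf_half) (w Q))"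

definition F_eps :: "real \<Rightarrow> (real \<Rightarrow> complex) \<Rightarrow> (real \<Rightarrow> complex) \<Rightarrow> complex \<Rightarrow> complex" where
  "F_eps \<epsilon> v u s = (\<Sum>\<^sub>\<infinity>Q\<in>Sq_odd. F_term v (rescale \<epsilon> u) s Q)"

definition F_zero :: "(real \<Rightarrow> complex) \<Rightarrow> (real \<Rightarrow> complex) \<Rightarrow> complex \<Rightarrow> complex" where
  "F_zero v u s = (\<Sum>\<^sub>\<infinity>Q\<in>Sq_odd. F_term v (\<lambda>_. u) s Q)"

end

theory Submission
  imports Defs
begin

text \<open>
  Expand \<open>a' (gcd j k)\<close> as \<open>\<Sum> (-1) ^ card S * \<Prod>S\<close> over the sets \<open>S\<close> of odd prime divisors of \<open>j\<close>
  with \<open>\<Prod>S dvd k\<close>, and apply Poisson summation in \<open>k\<close>. With \<open>T = \<Prod>S\<close> and \<open>j = T m\<close>, this evaluates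
  \<open>cnj (v x) * w y\<close> at \<open>x = T m / Q + l Q / T\<close>, \<open>y = T m / Q - l Q / T\<close>, so that
  \<open>x\<^sup>2 - y\<^sup>2 = 4 l m\<close>; the supports leave only \<open>l = m = 1\<close>. Each term of the Dirichlet series is thus a
  finite sum over \<open>j \<le> 2 Q\<close> of \<open>\<mu>(j) cnj (v x) w y\<close> with \<open>x = j / Q + Q / j\<close>,
  \<open>y = j / Q - Q / j\<close>, and \<open>x\<^sup>2 = 4 + y\<^sup>2\<close>. For \<open>w = u\<^sub>Q\<close> the point \<open>x\<close> is within
  \<open>Q powr (-2 \<epsilon>)\<close> of 2, where \<open>v\<close> is flat: the terms decay faster than any power of \<open>Q\<close>, and the
  series is entire. The trivial bound \<open>O(Q powr (1 + \<epsilon> / 2 - Re s))\<close> gives dominated convergence as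
  \<open>\<epsilon> \<rightarrow> 0\<close> when \<open>Re s > 2\<close>.
\<close>

subsection \<open>Poisson summation\<close>

lemma has_vector_derivative_cis_linear:
  "((\<lambda>t. cis (c * t)) has_vector_derivative \<i> * c * cis (c * t)) (at t within A)"
proof -
  have "((\<lambda>t. exp (of_real t * (\<i> * of_real c))) has_vector_derivative
          (\<i> * of_real c) * exp (of_real t * (\<i> * of_real c))) (at t within A)"
    by (auto intro!: derivative_eq_intros has_vector_derivative_real_field)
  then show ?thesis
    by (simp add: cis_conv_exp mult_ac)
qed

lemma continuous_on_cis_linear [continuous_intros]:
  "continuous_on A (\<lambda>t::real. cis (2 * pi * t * \<xi>))"
  by (intro continuous_intros)

text \<open>The fundamental theorem of calculus applied to
  \<open>g t * cis (2 * pi * t * \<xi>)\<close>. The factor \<open>2 * pi * \<i> * \<xi>\<close>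
  stays on the left, so that \<open>\<xi> = 0\<close> needs no exception.\<close>

lemma integral_cis_by_parts:
  fixes g g' :: "real \<Rightarrow> complex"
  assumes "a \<le> b"
    and deriv: "\<And>t. t \<in> {a..b} \<Longrightarrow> (g has_vector_derivative g' t) (at t within {a..b})"
    and cont: "continuous_on {a..b} g'"
  shows "2 * pi * \<i> * \<xi> * integral {a..b} (\<lambda>t. g t * cis (2 * pi * t * \<xi>)) =
         g b * cis (2 * pi * b * \<xi>) - g a * cis (2 * pi * a * \<xi>) -
         integral {a..b} (\<lambda>t. g' t * cis (2 * pi * t * \<xi>))"
proof -
  have contg: "continuous_on {a..b} g"
    using has_vector_derivative_continuous[OF deriv] continuous_on_eq_continuous_within by blast
  have "((\<lambda>t. g t * (\<i> * (2 * pi * \<xi>) * cis (2 * pi * t * \<xi>)) + g' t * cis (2 * pi * t * \<xi>))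
     has_integral g b * cis (2 * pi * b * \<xi>) - g a * cis (2 * pi * a * \<xi>)) {a..b}"
  proof (rule fundamental_theorem_of_calculus[OF \<open>a \<le> b\<close>])
    fix t assume t: "t \<in> {a..b}"
    have "((\<lambda>t. g t * cis (2 * pi * t * \<xi>)) has_vector_derivative
        g t * (\<i> * of_real (2 * pi * \<xi>) * cis (2 * pi * \<xi> * t)) + g' t * cis (2 * pi * t * \<xi>))
        (at t within {a..b})"
      using has_vector_derivative_mult[OF deriv[OF t]
          has_vector_derivative_cis_linear[of "2 * pi * \<xi>" t "{a..b}"]]
      by (simp add: mult_ac)
    then show "((\<lambda>t. g t * cis (2 * pi * t * \<xi>)) has_vector_derivative
        g t * (\<i> * (2 * pi * \<xi>) * cis (2 * pi * t * \<xi>)) + g' t * cis (2 * pi * t * \<xi>))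
        (at t within {a..b})"
      by (simp add: mult_ac)
  qed
  moreover have "((\<lambda>t. g t * (\<i> * (2 * pi * \<xi>) * cis (2 * pi * t * \<xi>)) + g' t * cis (2 * pi * t * \<xi>))
     has_integral \<i> * (2 * pi * \<xi>) * integral {a..b} (\<lambda>t. g t * cis (2 * pi * t * \<xi>)) +
       integral {a..b} (\<lambda>t. g' t * cis (2 * pi * t * \<xi>))) {a..b}"
  proof (rule has_integral_add)
    have "((\<lambda>t. \<i> * (2 * pi * \<xi>) * (g t * cis (2 * pi * t * \<xi>))) has_integral
       \<i> * (2 * pi * \<xi>) * integral {a..b} (\<lambda>t. g t * cis (2 * pi * t * \<xi>))) {a..b}"
      by (intro has_integral_mult_right integrable_integral integrable_continuous_interval
          continuous_intros contg)
    then show "((\<lambda>t. g t * (\<i> * (2 * pi * \<xi>) * cis (2 * pi * t * \<xi>))) has_integral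
       \<i> * (2 * pi * \<xi>) * integral {a..b} (\<lambda>t. g t * cis (2 * pi * t * \<xi>))) {a..b}"
      by (simp add: mult_ac)
  qed (intro integrable_integral integrable_continuous_interval continuous_intros cont)
  ultimately have "\<i> * (2 * pi * \<xi>) * integral {a..b} (\<lambda>t. g t * cis (2 * pi * t * \<xi>)) +
       integral {a..b} (\<lambda>t. g' t * cis (2 * pi * t * \<xi>)) =
       g b * cis (2 * pi * b * \<xi>) - g a * cis (2 * pi * a * \<xi>)"
    by (rule has_integral_unique[rotated])
  then show ?thesis by (simp add: algebra_simps)
qed

text \<open>Polynomials are uniformly dense, and for a polynomial one integration by parts gives
  decay of order \<open>1 / \<bar>\<xi>\<bar>\<close>. The approximation error is uniform in
  \<open>\<xi>\<close> because \<open>cis\<close> has modulus 1.\<close>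

lemma riemann_lebesgue:
  fixes f :: "real \<Rightarrow> complex"
  assumes "a \<le> b" and cont: "continuous_on {a..b} f"
  shows "((\<lambda>\<xi>. integral {a..b} (\<lambda>t. f t * cis (2 * pi * t * \<xi>))) \<longlongrightarrow> 0) at_infinity"
proof (rule tendstoI)
  fix e :: real assume "e > 0"
  \<comment> \<open>The \<open>+ 1\<close> keeps the denominator positive when \<open>a = b\<close>
    and makes \<open>d * (b - a) < e / 2\<close> strict.\<close>
  define d where "d = e / (2 * (b - a + 1))"
  have "d > 0" using \<open>e > 0\<close> \<open>a \<le> b\<close> by (simp add: d_def)
  obtain p where p: "polynomial_function p" and fp: "\<And>t. t \<in> {a..b} \<Longrightarrow> norm (f t - p t) < d"
    using Stone_Weierstrass_polynomial_function[OF compact_Icc cont \<open>d > 0\<close>] by blast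
  obtain p' where p': "polynomial_function p'" "\<And>t. (p has_vector_derivative p' t) (at t)"
    using has_vector_derivative_polynomial_function[OF p] by blast
  have contp: "continuous_on {a..b} p" "continuous_on {a..b} p'"
    using p p' by (auto intro: continuous_on_polymonial_function)
  obtain B where B: "\<And>t. t \<in> {a..b} \<Longrightarrow> norm (p' t) \<le> B"
    using compact_imp_bounded[OF compact_continuous_image[OF contp(2) compact_Icc]]
    unfolding bounded_iff by (metis imageI)
  define M where "M = norm (p b) + norm (p a) + B * (b - a)"
  have bound: "2 * pi * \<bar>\<xi>\<bar> * norm (integral {a..b} (\<lambda>t. p t * cis (2 * pi * t * \<xi>))) \<le> M" for \<xi>
  proof -
    let ?I = "integral {a..b} (\<lambda>t. p t * cis (2 * pi * t * \<xi>))"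
    let ?I' = "integral {a..b} (\<lambda>t. p' t * cis (2 * pi * t * \<xi>))"
    have I': "norm ?I' \<le> B * (b - a)"
      using \<open>a \<le> b\<close> B by (intro integral_bound continuous_intros contp) (auto simp: norm_mult)
    have "2 * pi * \<bar>\<xi>\<bar> * norm ?I = norm (2 * pi * \<i> * \<xi> * ?I)"
      by (simp add: norm_mult)
    also have "2 * pi * \<i> * \<xi> * ?I =
       p b * cis (2 * pi * b * \<xi>) - p a * cis (2 * pi * a * \<xi>) - ?I'"
      using \<open>a \<le> b\<close> p'(2) contp(2)
      by (intro integral_cis_by_parts) (auto intro: has_vector_derivative_at_within)
    also have "norm \<dots> \<le> norm (p b * cis (2 * pi * b * \<xi>)) + norm (p a * cis (2 * pi * a * \<xi>)) + norm ?I'"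
      by (intro order_trans[OF norm_triangle_ineq4] add_right_mono norm_triangle_ineq4)
    also have "\<dots> \<le> M"
      using I' by (simp add: M_def norm_mult)
    finally show ?thesis .
  qed
  have "norm (integral {a..b} (\<lambda>t. f t * cis (2 * pi * t * \<xi>))) < e"
    if \<xi>: "\<xi> \<noteq> 0" "norm \<xi> \<ge> M / e" for \<xi> :: real
  proof -
    have "norm (integral {a..b} (\<lambda>t. (f t - p t) * cis (2 * pi * t * \<xi>))) \<le> d * (b - a)"
      using \<open>a \<le> b\<close> fp
      by (intro integral_bound continuous_intros contp cont) (auto simp: norm_mult intro: less_imp_le)
    also have "\<dots> < e / 2"
      using \<open>e > 0\<close> \<open>a \<le> b\<close> by (simp add: d_def field_simps)
    finally have 1: "norm (integral {a..b} (\<lambda>t. (f t - p t) * cis (2 * pi * t * \<xi>))) < e / 2" .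
    have "norm (integral {a..b} (\<lambda>t. p t * cis (2 * pi * t * \<xi>))) \<le> M / (2 * pi * \<bar>\<xi>\<bar>)"
      using bound[of \<xi>] \<xi>(1) by (simp add: field_simps)
    also have "\<dots> \<le> e / (2 * pi)"
      using \<xi> \<open>e > 0\<close> by (simp add: field_simps)
    also have "\<dots> < e / 2"
      using \<open>e > 0\<close> pi_gt3 by (intro divide_strict_left_mono) auto
    finally have 2: "norm (integral {a..b} (\<lambda>t. p t * cis (2 * pi * t * \<xi>))) < e / 2" .
    have "integral {a..b} (\<lambda>t. f t * cis (2 * pi * t * \<xi>)) =
      integral {a..b} (\<lambda>t. (f t - p t) * cis (2 * pi * t * \<xi>)) +
      integral {a..b} (\<lambda>t. p t * cis (2 * pi * t * \<xi>))"
      by (subst integral_add[symmetric])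
        (auto intro!: integrable_continuous_interval continuous_intros contp cont simp: algebra_simps)
    with 1 2 show ?thesis
      by (simp add: norm_triangle_lt)
  qed
  then show "\<forall>\<^sub>F \<xi> in at_infinity.
      dist (integral {a..b} (\<lambda>t. f t * cis (2 * pi * t * \<xi>))) 0 < e"
    unfolding eventually_at_infinity
    \<comment> \<open>The 1 in the maximum excludes \<open>\<xi> = 0\<close>.\<close>
    by (intro exI[of _ "max 1 (M / e)"]) auto
qed

section \<open>Fourier series at a point of differentiability\<close>

text \<open>Guarantees that a quotient by \<open>cis (2 * pi * t) - 1\<close> is singular only at 0
  on the period interval.\<close>

lemma cis_2pi_eq_1_half_period:
  assumes "\<bar>t\<bar> \<le> 1 / 2" "cis (2 * pi * t) = 1"
  shows "t = 0"
proof -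
  have "cos (2 * pi * t) = 1" using assms(2) by (simp add: complex_eq_iff)
  then obtain n :: int where "2 * pi * t = of_int n * 2 * pi"
    by (auto simp: cos_one_2pi_int)
  then have t: "t = of_int n" by simp
  with assms(1) have "n = 0" by simp
  with t show ?thesis by simp
qed

text \<open>This quotient form lets the difference quotients of two functions be divided by each
  other.\<close>

lemma vector_derivative_difference_quotient:
  fixes f :: "real \<Rightarrow> complex"
  assumes "(f has_vector_derivative f') (at 0)"
  shows "((\<lambda>t. (f t - f 0) / of_real t) \<longlongrightarrow> f') (at 0)"
proof -
  have lim: "((\<lambda>t. norm ((f t - f 0 - t *\<^sub>R f') /\<^sub>R norm t)) \<longlongrightarrow> 0) (at 0)"
    using assms by (intro tendsto_norm_zero)
      (simp add: has_vector_derivative_def has_derivative_within divide_inverse algebra_simps)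
  have "norm ((f t - f 0 - t *\<^sub>R f') /\<^sub>R norm t) = norm ((f t - f 0) / of_real t - f')"
    if "t \<noteq> 0" for t
  proof -
    have "norm ((f t - f 0) / of_real t - f') = norm ((f t - f 0 - t *\<^sub>R f') / of_real t)"
      using that by (simp add: diff_divide_distrib scaleR_conv_of_real)
    then show ?thesis by (simp add: norm_mult norm_inverse divide_inverse)
  qed
  then have "((\<lambda>t. norm ((f t - f 0) / of_real t - f')) \<longlongrightarrow> 0) (at 0)"
    by (intro Lim_transform_eventually[OF lim]) (simp add: eventually_at_filter)
  then show ?thesis
    by (rule LIM_zero_cancel[OF tendsto_norm_zero_cancel])
qed

text \<open>The summand has the shape that the Fourier coefficients take below: the constant
  function contributes only at \<open>m = 0\<close>, and the rest is a difference of consecutive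
  coefficients.\<close>

lemma sum_telescope_symmetric:
  fixes G :: "int \<Rightarrow> 'a :: comm_ring_1"
  shows "(\<Sum>m=-int N..int N. (if m = 0 then c else 0) + (G (m + 1) - G m)) =
           c + (G (int N + 1) - G (- int N))"
proof (induction N)
  case (Suc N)
  have "{-int (Suc N)..int (Suc N)} = insert (-1 - int N) (insert (1 + int N) {-int N..int N})"
    by auto
  then show ?case
    by (simp add: Suc.IH) (simp add: add_ac)
qed simp

text \<open>Writing \<open>f t = f 0 + (cis (2 * pi * t) - 1) * h t\<close> makes the symmetric partial sums of
  the Fourier series at 0 telescope to two Fourier coefficients of \<open>h\<close>.\<close>

lemma fourier_series_at_0:
  fixes f :: "real \<Rightarrow> complex"
  assumes cont: "continuous_on {-1/2..1/2} f" and deriv: "(f has_vector_derivative f') (at 0)"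
  shows "(\<lambda>N::nat. \<Sum>m=-int N..int N. integral {-1/2..1/2} (\<lambda>t. f t * cis (2 * pi * t * of_int m)))
           \<longlonglongrightarrow> f 0"
proof -
  define e where "e = (\<lambda>t::real. cis (2 * pi * t) - 1)"
  \<comment> \<open>The value at 0 is the limit of the quotient there, since \<open>e\<close> has
    derivative \<open>2 * pi * \<i>\<close> at 0; it makes \<open>h\<close> continuous.\<close>
  define h where "h = (\<lambda>t. if t = 0 then f' / (2 * pi * \<i>) else (f t - f 0) / e t)"
  have e0: "e t \<noteq> 0" if "\<bar>t\<bar> \<le> 1 / 2" "t \<noteq> 0" for t
    using cis_2pi_eq_1_half_period that by (auto simp: e_def)
  have fh: "f t = f 0 + e t * h t" if "\<bar>t\<bar> \<le> 1 / 2" for t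
    using e0[OF that] by (auto simp: h_def e_def)
  have conth: "continuous_on {-1/2..1/2} h"
    unfolding continuous_on_def
  proof
    fix t :: real assume t: "t \<in> {-1/2..1/2}"
    then have t2: "\<bar>t\<bar> \<le> 1 / 2" unfolding atLeastAtMost_iff abs_le_iff by linarith
    show "(h \<longlongrightarrow> h t) (at t within {-1/2..1/2})"
    proof (cases "t = 0")
      case False
      have "(f \<longlongrightarrow> f t) (at t within {-1/2..1/2})"
        using cont t by (auto simp: continuous_on_def)
      then have "((\<lambda>t. (f t - f 0) / e t) \<longlongrightarrow> (f t - f 0) / e t) (at t within {-1/2..1/2})"
        using e0[of t] t2 False unfolding e_def
        by (intro tendsto_intros) auto
      then have "((\<lambda>t. (f t - f 0) / e t) \<longlongrightarrow> h t) (at t within {-1/2..1/2})"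
        using False by (simp add: h_def)
      then show ?thesis
        by (rule Lim_transform_within[where d = "\<bar>t\<bar>"]) (use False in \<open>auto simp: h_def dist_real_def\<close>)
    next
      case True
      have "(e has_vector_derivative \<i> * of_real (2 * pi)) (at 0)"
        unfolding e_def
        using has_vector_derivative_diff[OF has_vector_derivative_cis_linear[of "2 * pi" 0 UNIV]
            has_vector_derivative_const[of 1]]
        by simp
      then have "((\<lambda>t. e t / of_real t) \<longlongrightarrow> \<i> * of_real (2 * pi)) (at 0)"
        using vector_derivative_difference_quotient[of e] by (simp add: e_def)
      \<comment> \<open>Numerator and denominator are both divided by \<open>t\<close>, so each
        tends to a derivative.\<close>
      then have quot: "((\<lambda>t. ((f t - f 0) / of_real t) / (e t / of_real t)) \<longlongrightarrow> f' / (\<i> * of_real (2 * pi))) (at 0)"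
        by (intro tendsto_divide vector_derivative_difference_quotient deriv) auto
      have "((f t - f 0) / of_real t) / (e t / of_real t) = h t" if "t \<noteq> 0" for t
        using that by (simp add: h_def)
      then have "(h \<longlongrightarrow> f' / (\<i> * of_real (2 * pi))) (at 0)"
        by (intro Lim_transform_eventually[OF quot]) (simp add: eventually_at_filter)
      then show ?thesis
        using True tendsto_within_subset[OF _ subset_UNIV] by (simp add: h_def mult_ac)
    qed
  qed
  define H where "H = (\<lambda>\<xi>. integral {-1/2..1/2} (\<lambda>t. h t * cis (2 * pi * t * \<xi>)))"
  \<comment> \<open>Orthogonality of the exponentials: integrating the constant 1 by parts leaves
    only the boundary terms, which agree at \<open>1/2\<close> and \<open>-1/2\<close>.\<close>
  have one: "integral {-1/2..1/2} (\<lambda>t. cis (2 * pi * t * of_int m)) = (if m = 0 then 1 else 0)" for m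
  proof (cases "m = 0")
    case False
    have "cis (pi * m) = cis (- (pi * m) + 2 * pi * m)"
      by simp
    also have "\<dots> = cis (- (pi * m)) * cis (2 * pi * m)"
      by (rule cis_mult[symmetric])
    also have "cis (2 * pi * m) = 1"
      by (rule cis_multiple_2pi) simp
    finally have "cis (pi * m) = cis (- (pi * m))"
      by simp
    then have "2 * pi * \<i> * of_int m * integral {-1/2..1/2} (\<lambda>t. 1 * cis (2 * pi * t * of_int m)) = 0"
      using integral_cis_by_parts[of "-1/2" "1/2" "\<lambda>_. 1" "\<lambda>_. 0" "of_int m"] by simp
    with False show ?thesis by simp
  qed simp
  \<comment> \<open>Multiplying \<open>h\<close> by \<open>cis (2 * pi * t)\<close> raises its
    frequency by one, which produces the difference of consecutive values of
    \<open>H\<close>.\<close>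
  have coeff: "integral {-1/2..1/2} (\<lambda>t. f t * cis (2 * pi * t * of_int m)) =
      (if m = 0 then f 0 else 0) + (H (of_int (m + 1)) - H (of_int m))" for m
  proof -
    have split: "f t * cis (2 * pi * t * of_int m) = f 0 * cis (2 * pi * t * of_int m) +
        (h t * cis (2 * pi * t * of_int (m + 1)) - h t * cis (2 * pi * t * of_int m))"
      if "t \<in> {-1/2..1/2}" for t
    proof -
      have "f t = f 0 + (cis (2 * pi * t) - 1) * h t"
        using that fh[of t] by (auto simp: e_def abs_le_iff)
      moreover have "cis (2 * pi * t * of_int (m + 1)) = cis (2 * pi * t * of_int m) * cis (2 * pi * t)"
        by (simp add: cis_mult algebra_simps)
      ultimately show ?thesis by (simp only:) (simp add: ring_distribs)
    qed
    have "integral {-1/2..1/2} (\<lambda>t. f t * cis (2 * pi * t * of_int m)) =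
       integral {-1/2..1/2} (\<lambda>t. f 0 * cis (2 * pi * t * of_int m) +
        (h t * cis (2 * pi * t * of_int (m + 1)) - h t * cis (2 * pi * t * of_int m)))"
      by (rule Henstock_Kurzweil_Integration.integral_cong) (rule split)
    also have "\<dots> = f 0 * integral {-1/2..1/2} (\<lambda>t. cis (2 * pi * t * of_int m)) +
        (H (of_int (m + 1)) - H (of_int m))"
      unfolding H_def
      by (intro integral_unique has_integral_add has_integral_diff has_integral_mult_right
        integrable_integral integrable_continuous_interval continuous_intros conth)
    finally show ?thesis unfolding one by simp
  qed
  have sum: "(\<Sum>m=-int N..int N. integral {-1/2..1/2} (\<lambda>t. f t * cis (2 * pi * t * of_int m))) =
      f 0 + (H (of_int (int N + 1)) - H (of_int (- int N)))" for N
    unfolding coeff by (rule sum_telescope_symmetric[where G = "\<lambda>m. H (of_int m)"])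
  have H: "(H \<longlongrightarrow> 0) at_infinity"
    unfolding H_def by (rule riemann_lebesgue[OF _ conth]) auto
  have "(\<lambda>N. H (of_int (int N + 1))) \<longlonglongrightarrow> 0" "(\<lambda>N. H (of_int (- int N))) \<longlonglongrightarrow> 0"
  proof -
    have "filterlim (\<lambda>N. real (Suc N)) at_infinity sequentially"
      by (rule filterlim_compose[OF tendsto_of_nat filterlim_Suc])
    from filterlim_compose[OF H this] show "(\<lambda>N. H (of_int (int N + 1))) \<longlonglongrightarrow> 0"
      by (simp add: add.commute)
    have "filterlim (\<lambda>N. - real N) at_infinity sequentially"
      by (rule filterlim_norm_at_top_imp_at_infinity) (simp add: filterlim_real_sequentially)
    from filterlim_compose[OF H this] show "(\<lambda>N. H (of_int (- int N))) \<longlonglongrightarrow> 0"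
      by simp
  qed
  then have "(\<lambda>N. f 0 + (H (of_int (int N + 1)) - H (of_int (- int N)))) \<longlonglongrightarrow> f 0 + (0 - 0)"
    by (intro tendsto_intros)
  then show ?thesis unfolding sum by simp
qed

section \<open>Poisson summation on the integers\<close>

text \<open>The majorant for Fourier coefficients of order \<open>m\<close> to the power -2. At
  \<open>m = 0\<close> the term is \<open>inverse 0 = 0\<close>.\<close>

lemma summable_on_inverse_power2_int:
  "(\<lambda>m::int. inverse (of_int m ^ 2 :: real)) summable_on UNIV"
proof -
  have nat: "(\<lambda>n::nat. inverse (of_nat n ^ 2 :: real)) summable_on UNIV"
    by (intro norm_summable_imp_summable_on) (use inverse_power_summable[of 2] in simp)
  have "(\<lambda>m::int. inverse (of_int m ^ 2 :: real)) summable_on range int"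
    using nat by (subst summable_on_reindex) (auto simp: o_def)
  moreover have "(\<lambda>m::int. inverse (of_int m ^ 2 :: real)) summable_on range (\<lambda>n. - int n)"
    using nat by (subst summable_on_reindex) (auto simp: o_def inj_on_def)
  ultimately have "(\<lambda>m::int. inverse (of_int m ^ 2 :: real)) summable_on (range int \<union> range (\<lambda>n. - int n))"
    by (rule summable_on_union)
  moreover have "range int \<union> range (\<lambda>n. - int n) = UNIV"
    by (auto intro: int_cases2)
  ultimately show ?thesis by simp
qed

text \<open>Every finite set of integers lies in some symmetric interval. This links unconditional
  sums to the symmetric partial sums of Fourier series.\<close>

lemma has_sum_imp_symmetric_limit:
  fixes f :: "int \<Rightarrow> 'a :: {comm_monoid_add, topological_space}"
  assumes "(f has_sum S) UNIV"
  shows "(\<lambda>N::nat. \<Sum>m=-int N..int N. f m) \<longlonglongrightarrow> S"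
proof -
  have "filterlim (\<lambda>N::nat. {-int N..int N}) (finite_subsets_at_top UNIV) sequentially"
    unfolding filterlim_finite_subsets_at_top
  proof (intro allI impI)
    fix X :: "int set" assume "finite X \<and> X \<subseteq> UNIV"
    then have bound: "\<bar>x\<bar> \<le> Max (insert 0 (abs ` X))" if "x \<in> X" for x
      using that by (intro Max_ge) auto
    have "X \<subseteq> {-int N..int N}" if "N \<ge> nat (Max (insert 0 (abs ` X)))" for N
    proof
      fix x assume "x \<in> X"
      from bound[OF this] that show "x \<in> {-int N..int N}" by auto
    qed
    then show "\<forall>\<^sub>F N in sequentially. finite {-int N..int N} \<and> X \<subseteq> {-int N..int N} \<and> {-int N..int N} \<subseteq> UNIV"
      by (auto simp: eventually_sequentially)
  qed
  with assms show ?thesis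
    unfolding has_sum_def by (rule filterlim_compose)
qed

text \<open>The unit intervals are centred at integers, so the value of a function at an integer
  becomes the value at 0 of a translate.\<close>

lemma integral_split_unit_intervals:
  fixes F :: "real \<Rightarrow> complex"
  assumes cont: "continuous_on UNIV F"
  shows "integral {-(real K + 1/2)..real K + 1/2} F =
           (\<Sum>l=-int K..int K. integral {-1/2..1/2} (\<lambda>t. F (t + of_int l)))"
proof (induction K)
  case (Suc K)
  have int: "F integrable_on {a..b}" for a b
    by (rule integrable_continuous_interval[OF continuous_on_subset[OF cont subset_UNIV]])
  have shift: "integral {-1/2..1/2} (\<lambda>t. F (t + of_int l)) = integral {of_int l - 1/2..of_int l + 1/2} F" for l
    using integral_shift_real_ivl[of "of_int l - 1/2" "of_int l" "of_int l + 1/2" F] by simp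
  let ?r = "real K + 1/2"
  have "integral {-(?r + 1)..?r + 1} F = integral {-(?r + 1)..-?r} F + integral {-?r..?r + 1} F"
    by (rule Henstock_Kurzweil_Integration.integral_combine[symmetric]) (auto simp: int)
  also have "integral {-?r..?r + 1} F = integral {-?r..?r} F + integral {?r..?r + 1} F"
    by (rule Henstock_Kurzweil_Integration.integral_combine[symmetric]) (auto simp: int)
  also have "integral {-(?r + 1)..-?r} F = integral {-1/2..1/2} (\<lambda>t. F (t + of_int (-1 - int K)))"
    unfolding shift by (rule arg_cong2[where f = integral]) auto
  also have "integral {?r..?r + 1} F = integral {-1/2..1/2} (\<lambda>t. F (t + of_int (1 + int K)))"
    unfolding shift by (rule arg_cong2[where f = integral]) auto
  also have "integral {-?r..?r} F = (\<Sum>l=-int K..int K. integral {-1/2..1/2} (\<lambda>t. F (t + of_int l)))"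
    by (rule Suc.IH)
  finally have *: "integral {-(?r + 1)..?r + 1} F =
     integral {-1/2..1/2} (\<lambda>t. F (t + of_int (-1 - int K))) +
       ((\<Sum>l=-int K..int K. integral {-1/2..1/2} (\<lambda>t. F (t + of_int l))) +
        integral {-1/2..1/2} (\<lambda>t. F (t + of_int (1 + int K))))" .
  have "{-int (Suc K)..int (Suc K)} = insert (-1 - int K) (insert (1 + int K) {-int K..int K})"
    by auto
  then have "(\<Sum>l=-int (Suc K)..int (Suc K). integral {-1/2..1/2} (\<lambda>t. F (t + of_int l))) =
      integral {-1/2..1/2} (\<lambda>t. F (t + of_int (-1 - int K))) +
       (integral {-1/2..1/2} (\<lambda>t. F (t + of_int (1 + int K))) +
       (\<Sum>l=-int K..int K. integral {-1/2..1/2} (\<lambda>t. F (t + of_int l))))"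
    by simp
  moreover have "real (Suc K) + 1/2 = ?r + 1" by simp
  ultimately show ?case using * by (simp only: add.commute)
qed simp

text \<open>The region \<open>\<bar>t\<bar> > R\<close> is open and \<open>g\<close> is constantly 0
  there. This removes the boundary terms of the second integration by parts.\<close>

lemma vector_derivative_zero_outside:
  fixes g :: "real \<Rightarrow> complex"
  assumes "\<And>t. (g has_vector_derivative g' t) (at t)"
    and "\<And>t. \<bar>t\<bar> \<ge> R \<Longrightarrow> g t = 0" and "\<bar>t\<bar> > R"
  shows "g' t = 0"
proof -
  have "open {t. \<bar>t\<bar> > R}" by (intro open_Collect_less continuous_intros)
  then have "((\<lambda>_. 0) has_vector_derivative g' t) (at t)"
    by (rule has_vector_derivative_transform_within_open[OF assms(1)]) (use assms in auto)
  then show ?thesis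
    by (rule vector_derivative_unique_at) (rule has_vector_derivative_const)
qed

text \<open>Two integrations by parts give quadratic decay of the integrals, hence unconditional
  summability. The sum is then identified along symmetric intervals, where each translate of
  \<open>g\<close> contributes its Fourier series at 0.\<close>

lemma poisson_summation_unit:
  fixes g g' g'' :: "real \<Rightarrow> complex"
  assumes d1: "\<And>t. (g has_vector_derivative g' t) (at t)"
    and d2: "\<And>t. (g' has_vector_derivative g'' t) (at t)"
    and cont: "continuous_on UNIV g''"
    and supp: "\<And>t. \<bar>t\<bar> \<ge> real K \<Longrightarrow> g t = 0"
  shows "((\<lambda>m::int. integral {-(real K + 1/2)..real K + 1/2} (\<lambda>t. g t * cis (2 * pi * t * of_int m)))
           has_sum (\<Sum>l=-int K..int K. g (of_int l))) UNIV"
proof -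
  \<comment> \<open>A half-integer endpoint fits the unit intervals centred at integers and lies
    strictly outside the support, so \<open>g\<close> and \<open>g'\<close> both vanish
    there.\<close>
  define R where "R = real K + 1 / 2"
  define I where "I = (\<lambda>m::int. integral {-R..R} (\<lambda>t. g t * cis (2 * pi * t * of_int m)))"
  have R: "-R \<le> R" by (simp add: R_def)
  have g0: "g R = 0" "g (-R) = 0" using supp by (simp_all add: R_def)
  have g'0: "g' R = 0" "g' (-R) = 0"
    using vector_derivative_zero_outside[OF d1 supp] by (auto simp: R_def)
  have contg: "continuous_on A g" "continuous_on A g'" for A
    by (simp_all add: continuous_at_imp_continuous_on has_vector_derivative_continuous[OF d1]
        has_vector_derivative_continuous[OF d2])
  have contg'': "continuous_on A g''" for A
    using cont continuous_on_subset by blast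
  obtain B where B: "\<And>t. t \<in> {-R..R} \<Longrightarrow> norm (g'' t) \<le> B"
    using compact_imp_bounded[OF compact_continuous_image[OF contg'' compact_Icc]]
    unfolding bounded_iff by (metis imageI)
  have bound: "norm (I m) \<le> B * (2 * R) * inverse (of_int m ^ 2)" if "m \<noteq> 0" for m
  proof -
    let ?I' = "integral {-R..R} (\<lambda>t. g' t * cis (2 * pi * t * of_int m))"
    let ?I'' = "integral {-R..R} (\<lambda>t. g'' t * cis (2 * pi * t * of_int m))"
    let ?c = "complex_of_real (2 * pi) * \<i> * complex_of_real (of_int m)"
    have "?c * I m = - ?I'"
      using integral_cis_by_parts[OF R has_vector_derivative_at_within[OF d1] contg(2), of "of_int m"]
      by (simp add: I_def g0)
    moreover have "?c * ?I' = - ?I''"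
      using integral_cis_by_parts[OF R has_vector_derivative_at_within[OF d2] contg'', of "of_int m"]
      by (simp add: g'0)
    ultimately have "?c * (?c * I m) = ?I''" by simp
    then have "norm (?c * (?c * I m)) = norm ?I''" by simp
    also have "\<dots> \<le> B * (R - (-R))"
      using R B by (intro integral_bound continuous_intros contg'') (auto simp: norm_mult)
    finally have *: "(2 * pi)\<^sup>2 * (of_int m ^ 2 * norm (I m)) \<le> B * (2 * R)"
      by (simp add: norm_mult power2_eq_square mult_ac abs_mult_self_eq flip: abs_mult)
    have "1 \<le> (2 * pi)\<^sup>2"
      using pi_gt3 by (intro one_le_power) auto
    then have "1 * (of_int m ^ 2 * norm (I m)) \<le> (2 * pi)\<^sup>2 * (of_int m ^ 2 * norm (I m))"
      by (intro mult_right_mono) auto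
    then have "of_int m ^ 2 * norm (I m) \<le> B * (2 * R)"
      using * by linarith
    then show ?thesis using that by (simp add: field_simps)
  qed
  have "I summable_on UNIV"
  proof (rule abs_summable_summable, rule summable_on_comparison_test)
    \<comment> \<open>The \<open>of_bool\<close> term covers \<open>m = 0\<close>, where the inverse
      square is 0.\<close>
    show "(\<lambda>m. of_bool (m = 0) * norm (I 0) + B * (2 * R) * inverse (of_int m ^ 2)) summable_on UNIV"
      by (intro summable_on_add summable_on_cmult_right summable_on_inverse_power2_int
        finite_nonzero_values_imp_summable_on) simp
    fix m show "norm (I m) \<le> of_bool (m = 0) * norm (I 0) + B * (2 * R) * inverse (of_int m ^ 2)"
      using bound[of m] by (cases "m = 0") auto
  qed auto
  then have sum: "(I has_sum infsum I UNIV) UNIV" by simp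
  have "(\<lambda>N. \<Sum>m=-int N..int N. I m) \<longlonglongrightarrow> (\<Sum>l=-int K..int K. g (of_int l))"
  proof -
    \<comment> \<open>Translation by an integer \<open>l\<close> leaves the exponential unchanged
      because \<open>l * m\<close> is an integer; each integral is thus a finite sum of Fourier
      coefficients of translates.\<close>
    have I: "I m = (\<Sum>l=-int K..int K. integral {-1/2..1/2} (\<lambda>t. g (t + of_int l) * cis (2 * pi * t * of_int m)))" for m
    proof -
      have "cis (2 * pi * (t + of_int l) * of_int m) = cis (2 * pi * t * of_int m)" for t l
      proof -
        have "cis (2 * pi * (t + of_int l) * of_int m) = cis (2 * pi * t * of_int m) * cis (2 * pi * of_int (l * m))"
          by (simp add: cis_mult algebra_simps)
        also have "cis (2 * pi * of_int (l * m)) = 1"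
          by (rule cis_multiple_2pi) (rule Ints_of_int)
        finally show ?thesis by simp
      qed
      moreover have "continuous_on UNIV (\<lambda>t. g t * cis (2 * pi * t * of_int m))"
        by (intro continuous_intros contg)
      ultimately show ?thesis
        unfolding I_def R_def by (simp only: integral_split_unit_intervals)
    qed
    have "(\<lambda>N. \<Sum>l=-int K..int K. \<Sum>m=-int N..int N.
         integral {-1/2..1/2} (\<lambda>t. g (t + of_int l) * cis (2 * pi * t * of_int m))) \<longlonglongrightarrow>
         (\<Sum>l=-int K..int K. g (of_int l))"
    proof (rule tendsto_sum)
      fix l :: int
      have "((\<lambda>t. g (t + of_int l)) has_vector_derivative g' (of_int l)) (at 0)"
        using vector_diff_chain_at[of "\<lambda>t. t + of_int l" 1 0 g "g' (of_int l)"] d1[of "of_int l"]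
        by (simp add: o_def has_vector_derivative_add_const has_vector_derivative_id)
      moreover have "continuous_on {-1/2..1/2} (\<lambda>t. g (t + of_int l))"
        by (rule continuous_on_compose2[OF contg(1)[of UNIV]]) (auto intro: continuous_intros)
      ultimately show "(\<lambda>N. \<Sum>m=-int N..int N.
         integral {-1/2..1/2} (\<lambda>t. g (t + of_int l) * cis (2 * pi * t * of_int m))) \<longlonglongrightarrow> g (of_int l)"
        using fourier_series_at_0[of "\<lambda>t. g (t + of_int l)"] by simp
    qed
    then show ?thesis
      unfolding I by (subst sum.swap)
  qed
  then have "infsum I UNIV = (\<Sum>l=-int K..int K. g (of_int l))"
    by (rule LIMSEQ_unique[OF has_sum_imp_symmetric_limit[OF sum]])
  with sum show ?thesis unfolding I_def R_def by simp
qed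

section \<open>Functions with two continuous derivatives\<close>

text \<open>This is the regularity consumed by two integrations by parts. Closure under products and
  affine substitution is easier to show here than for the iterated \<open>vderiv\<close>.\<close>

definition twice_cont_diff :: "(real \<Rightarrow> complex) \<Rightarrow> bool" where
  "twice_cont_diff f \<longleftrightarrow> (\<exists>f' f''. (\<forall>t. (f has_vector_derivative f' t) (at t)) \<and>
     (\<forall>t. (f' has_vector_derivative f'' t) (at t)) \<and> continuous_on UNIV f'')"

lemma vderiv_has_vector_derivative:
  assumes "smooth f"
  shows "(vderiv j f has_vector_derivative vderiv (Suc j) f t) (at t)"
  using assms unfolding smooth_def vderiv_def by (simp add: vector_derivative_works)

lemma continuous_on_vderiv:
  assumes "smooth f"
  shows "continuous_on A (vderiv j f)"
  using has_vector_derivative_continuous[OF vderiv_has_vector_derivative[OF assms]]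
  by (simp add: continuous_at_imp_continuous_on)

lemma vderiv_0 [simp]: "vderiv 0 f = f"
  by (simp add: vderiv_def)

lemma smooth_imp_twice_cont_diff:
  assumes "smooth f"
  shows "twice_cont_diff f"
  unfolding twice_cont_diff_def
  using vderiv_has_vector_derivative[OF assms, of 0] vderiv_has_vector_derivative[OF assms, of 1]
    continuous_on_vderiv[OF assms]
  by (intro exI[of _ "vderiv 1 f"] exI[of _ "vderiv 2 f"]) (simp add: numeral_2_eq_2)

lemma twice_cont_diff_cnj:
  assumes "twice_cont_diff f"
  shows "twice_cont_diff (\<lambda>t. cnj (f t))"
proof -
  obtain f' f'' where f: "\<And>t. (f has_vector_derivative f' t) (at t)"
    "\<And>t. (f' has_vector_derivative f'' t) (at t)" "continuous_on UNIV f''"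
    using assms unfolding twice_cont_diff_def by blast
  show ?thesis unfolding twice_cont_diff_def
    by (intro exI[of _ "\<lambda>t. cnj (f' t)"] exI[of _ "\<lambda>t. cnj (f'' t)"] conjI allI
        bounded_linear.has_vector_derivative[OF bounded_linear_cnj] f continuous_intros)
qed

lemma twice_cont_diff_affine:
  assumes "twice_cont_diff f"
  shows "twice_cont_diff (\<lambda>t. f (a + b * t))"
proof -
  obtain f' f'' where f: "\<And>t. (f has_vector_derivative f' t) (at t)"
    "\<And>t. (f' has_vector_derivative f'' t) (at t)" "continuous_on UNIV f''"
    using assms unfolding twice_cont_diff_def by blast
  have aff: "((\<lambda>t. a + b * t) has_vector_derivative b) (at t)" for t
    unfolding has_real_derivative_iff_has_vector_derivative[symmetric]
    by (auto intro!: derivative_eq_intros)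
  have chain: "((\<lambda>t. g (a + b * t)) has_vector_derivative of_real b * g' (a + b * t)) (at t)"
    if "\<And>t. (g has_vector_derivative g' t) (at t)" for g g' :: "real \<Rightarrow> complex" and t
    using vector_diff_chain_at[OF aff that] by (simp add: o_def scaleR_conv_of_real)
  show ?thesis unfolding twice_cont_diff_def
    by (intro exI[of _ "\<lambda>t. of_real b * f' (a + b * t)"]
        exI[of _ "\<lambda>t. of_real b * (of_real b * f'' (a + b * t))"] conjI allI
        has_vector_derivative_mult_right chain f continuous_intros
        continuous_on_compose2[OF f(3)] subset_UNIV)
qed

lemma twice_cont_diff_mult:
  assumes "twice_cont_diff f" "twice_cont_diff g"
  shows "twice_cont_diff (\<lambda>t. f t * g t)"
proof -
  obtain f' f'' where f: "\<And>t. (f has_vector_derivative f' t) (at t)"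
    "\<And>t. (f' has_vector_derivative f'' t) (at t)" "continuous_on UNIV f''"
    using assms(1) unfolding twice_cont_diff_def by blast
  obtain g' g'' where g: "\<And>t. (g has_vector_derivative g' t) (at t)"
    "\<And>t. (g' has_vector_derivative g'' t) (at t)" "continuous_on UNIV g''"
    using assms(2) unfolding twice_cont_diff_def by blast
  have cont: "continuous_on UNIV f" "continuous_on UNIV g" "continuous_on UNIV f'" "continuous_on UNIV g'"
    by (simp_all add: continuous_at_imp_continuous_on has_vector_derivative_continuous[OF f(1)]
        has_vector_derivative_continuous[OF f(2)] has_vector_derivative_continuous[OF g(1)]
        has_vector_derivative_continuous[OF g(2)])
  show ?thesis unfolding twice_cont_diff_def
    by (intro exI[of _ "\<lambda>t. f t * g' t + f' t * g t"]
        exI[of _ "\<lambda>t. (f t * g'' t + f' t * g' t) + (f' t * g' t + f'' t * g t)"] conjI allI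
        has_vector_derivative_mult has_vector_derivative_add f g continuous_intros cont)
qed

lemma twice_cont_diff_const: "twice_cont_diff (\<lambda>_. c)"
  unfolding twice_cont_diff_def
  by (intro exI[of _ "\<lambda>_. 0"]) auto

lemma twice_cont_diff_continuous:
  assumes "twice_cont_diff f"
  shows "continuous_on A f"
proof -
  obtain f' where f: "\<And>t. (f has_vector_derivative f' t) (at t)"
    using assms unfolding twice_cont_diff_def by blast
  show ?thesis
    by (simp add: continuous_at_imp_continuous_on has_vector_derivative_continuous[OF f])
qed

section \<open>Poisson summation for a lattice of any spacing\<close>

text \<open>Connects the Lebesgue integral in \<open>wigner\<close> with the gauge integral of the
  Fourier arguments.\<close>

lemma lborel_integral_eq_integral_Icc:
  fixes f :: "real \<Rightarrow> complex"
  assumes "continuous_on {a..b} f" "\<And>t. t \<notin> {a..b} \<Longrightarrow> f t = 0"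
  shows "(LBINT t. f t) = integral {a..b} f"
proof -
  have "set_integrable lborel {a..b} f"
    by (rule borel_integrable_atLeastAtMost'[OF assms(1)])
  then have "(LBINT t:{a..b}. f t) = integral {a..b} f"
    by (rule set_borel_integral_eq_integral)
  moreover have "(LBINT t:{a..b}. f t) = (LBINT t. f t)"
    unfolding set_lebesgue_integral_def
    by (rule Bochner_Integration.integral_cong) (use assms(2) in \<open>auto simp: indicator_def\<close>)
  ultimately show ?thesis by simp
qed

text \<open>The substitution \<open>t = L * t'\<close> reduces this to unit spacing and contributes
  the Jacobian \<open>L\<close>. The condition on \<open>K\<close> makes the finite sum cover all
  lattice points in the support.\<close>

lemma poisson_summation:
  fixes g :: "real \<Rightarrow> complex"
  assumes g: "twice_cont_diff g" and supp: "\<And>t. \<bar>t\<bar> \<ge> R \<Longrightarrow> g t = 0"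
    and "L > 0" and K: "R \<le> real K * L"
  shows "((\<lambda>m::int. LBINT t. g t * cis (2 * pi * t * (of_int m / L)))
           has_sum of_real L * (\<Sum>l=-int K..int K. g (of_int l * L))) UNIV"
proof -
  \<comment> \<open>The summand \<open>0 +\<close> matches the affine form of
    \<open>twice_cont_diff_affine\<close> and of the change of variables.\<close>
  define h where "h = (\<lambda>t. of_real L * g (0 + L * t))"
  have "twice_cont_diff h"
    unfolding h_def by (intro twice_cont_diff_mult twice_cont_diff_const twice_cont_diff_affine g)
  then obtain h' h'' where h: "\<And>t. (h has_vector_derivative h' t) (at t)"
    "\<And>t. (h' has_vector_derivative h'' t) (at t)" "continuous_on UNIV h''"
    unfolding twice_cont_diff_def by blast
  have h0: "h t = 0" if "\<bar>t\<bar> \<ge> real K" for t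
  proof -
    have "R \<le> \<bar>t\<bar> * L"
      using K mult_right_mono[OF that, of L] \<open>L > 0\<close> by linarith
    also have "\<dots> = \<bar>L * t\<bar>"
      using \<open>L > 0\<close> by (simp add: abs_mult)
    finally show ?thesis by (simp add: h_def supp)
  qed
  have "(LBINT t. g t * cis (2 * pi * t * (of_int m / L))) =
     integral {-(real K + 1/2)..real K + 1/2} (\<lambda>t. h t * cis (2 * pi * t * of_int m))" for m :: int
  proof -
    have "(LBINT t. g t * cis (2 * pi * t * (of_int m / L))) =
       L *\<^sub>R (LBINT t. g (0 + L * t) * cis (2 * pi * (0 + L * t) * (of_int m / L)))"
      using lborel_integral_real_affine[of L "\<lambda>t. g t * cis (2 * pi * t * (of_int m / L))" 0] \<open>L > 0\<close>
      by simp
    also have "\<dots> = (LBINT t. L *\<^sub>R (g (0 + L * t) * cis (2 * pi * (0 + L * t) * (of_int m / L))))"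
      by simp
    also have "\<dots> = (LBINT t. h t * cis (2 * pi * t * of_int m))"
      using \<open>L > 0\<close> by (intro Bochner_Integration.integral_cong refl) (simp add: h_def scaleR_conv_of_real mult_ac)
    also have "\<dots> = integral {-(real K + 1/2)..real K + 1/2} (\<lambda>t. h t * cis (2 * pi * t * of_int m))"
    proof (rule lborel_integral_eq_integral_Icc)
      show "continuous_on {-(real K + 1/2)..real K + 1/2} (\<lambda>t. h t * cis (2 * pi * t * of_int m))"
        by (intro continuous_intros twice_cont_diff_continuous \<open>twice_cont_diff h\<close>)
      fix t assume "t \<notin> {-(real K + 1/2)..real K + 1/2}"
      then have "\<bar>t\<bar> \<ge> real K" by auto
      then show "h t * cis (2 * pi * t * of_int m) = 0" by (simp add: h0)
    qed
    finally show ?thesis .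
  qed
  moreover have "of_real L * (\<Sum>l=-int K..int K. g (of_int l * L)) = (\<Sum>l=-int K..int K. h (of_int l))"
    by (simp add: h_def sum_distrib_left mult_ac)
  ultimately show ?thesis
    using poisson_summation_unit[OF h h0] by simp
qed

subsection \<open>Odd prime divisors\<close>

definition odd_prime_divisors :: "int \<Rightarrow> int set" where
  "odd_prime_divisors j = {p. prime p \<and> odd p \<and> p dvd j}"

lemma finite_odd_prime_divisors: "j \<noteq> 0 \<Longrightarrow> finite (odd_prime_divisors j)"
  by (rule finite_subset[OF _ finite_divisors_int]) (auto simp: odd_prime_divisors_def)

lemma prod_primes_dvd_iff:
  fixes k :: int
  assumes "finite S" "\<And>p. p \<in> S \<Longrightarrow> prime p"
  shows "\<Prod>S dvd k \<longleftrightarrow> (\<forall>p\<in>S. p dvd k)"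
  using assms
proof (induction S rule: finite_induct)
  case (insert p S)
  have "coprime p (\<Prod>S)"
    using insert by (intro prod_coprime_right primes_coprime) auto
  then have "p * \<Prod>S dvd k \<longleftrightarrow> p dvd k \<and> \<Prod>S dvd k"
    by (metis divides_mult dvd_mult_left dvd_mult_right)
  with insert show ?case by simp
qed simp

text \<open>Expands the product of \<open>1 - p * of_bool (p dvd k)\<close> over the odd primes
  dividing \<open>j\<close>. The index set no longer involves \<open>k\<close>, which enters only
  through congruence conditions suited to Poisson summation.\<close>

lemma a'_gcd:
  assumes "j \<noteq> 0"
  shows "a' (gcd j k) =
    (\<Sum>S\<in>Pow (odd_prime_divisors j). (-1) ^ card S * \<Prod>S * of_bool (\<Prod>S dvd k))"
proof -
  let ?P = "odd_prime_divisors j"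
  have fin: "finite ?P" using assms by (rule finite_odd_prime_divisors)
  have "a' (gcd j k) = (\<Prod>p\<in>{p\<in>?P. p dvd k}. 1 - p)"
    unfolding a'_def by (rule prod.cong) (auto simp: odd_prime_divisors_def)
  also have "\<dots> = (\<Prod>p\<in>?P. 1 - p * of_bool (p dvd k))"
    by (rule prod.mono_neutral_cong_left[OF fin]) auto
  also have "\<dots> = (\<Sum>S\<in>Pow ?P. (-1) ^ card S * (\<Prod>p\<in>S. p * of_bool (p dvd k)))"
    by (simp add: prod_diff_conv_sum[OF fin])
  also have "\<dots> = (\<Sum>S\<in>Pow ?P. (-1) ^ card S * \<Prod>S * of_bool (\<Prod>S dvd k))"
  proof (rule sum.cong)
    fix S assume S: "S \<in> Pow ?P"
    have finS: "finite S" using S fin finite_subset by blast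
    have "(\<Prod>p\<in>S. p * of_bool (p dvd k)) = \<Prod>S * (\<Prod>p\<in>S. of_bool (p dvd k))"
      by (rule prod.distrib)
    also have "(\<Prod>p\<in>S. of_bool (p dvd k) :: int) = of_bool (\<Prod>S dvd k)"
    proof -
      have "(\<Prod>p\<in>S. of_bool (p dvd k) :: int) = of_bool (\<forall>p\<in>S. p dvd k)"
        using finS by (cases "\<forall>p\<in>S. p dvd k") (auto intro!: prod_zero)
      then show ?thesis
        using prod_primes_dvd_iff[OF finS, of k] S by (auto simp: odd_prime_divisors_def)
    qed
    finally show "(-1) ^ card S * (\<Prod>p\<in>S. p * of_bool (p dvd k)) =
        (-1) ^ card S * \<Prod>S * of_bool (\<Prod>S dvd k)"
      by simp
  qed simp
  finally show ?thesis .
qed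

text \<open>For positive \<open>j\<close> this is the Moebius function restricted to odd integers:
  the product condition says that \<open>j\<close> is odd and squarefree.\<close>

definition moebius_odd :: "int \<Rightarrow> complex" where
  "moebius_odd j = (if \<Prod>(odd_prime_divisors j) = j then (-1) ^ card (odd_prime_divisors j) else 0)"

lemma norm_moebius_odd_le: "norm (moebius_odd j) \<le> 1"
  by (simp add: moebius_odd_def norm_power)

text \<open>Only the full set can have product \<open>j\<close>: a prime dividing
  \<open>\<Prod>S\<close> divides, and so equals, some element of \<open>S\<close>.\<close>

lemma sum_subsets_odd_prime_divisors:
  assumes "j \<noteq> 0"
  shows "(\<Sum>S\<in>Pow (odd_prime_divisors j). (-1) ^ card S * (if \<Prod>S = j then z else 0)) = moebius_odd j * z"
proof -
  let ?P = "odd_prime_divisors j"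
  have fin: "finite ?P" using assms by (rule finite_odd_prime_divisors)
  have "S = ?P" if S: "S \<subseteq> ?P" and prod: "\<Prod>S = j" for S
  proof (rule antisym[OF S], rule subsetI)
    fix p assume p: "p \<in> ?P"
    have finS: "finite S" using S fin finite_subset by blast
    from p have "prime p" "p dvd \<Prod>S" by (auto simp: odd_prime_divisors_def prod)
    then obtain q where q: "q \<in> S" "p dvd q"
      using finS by (auto simp: prime_dvd_prod_iff)
    moreover have "prime q" using q S by (auto simp: odd_prime_divisors_def)
    ultimately have "p = q" using \<open>prime p\<close> primes_dvd_imp_eq by blast
    with q show "p \<in> S" by simp
  qed
  then have "(\<Sum>S\<in>Pow ?P. (-1) ^ card S * (if \<Prod>S = j then z else 0)) =
      (\<Sum>S\<in>{?P}. (-1) ^ card S * (if \<Prod>S = j then z else 0))"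
    using fin by (intro sum.mono_neutral_right) auto
  then show ?thesis by (simp add: moebius_odd_def)
qed

lemma has_sum_sum:
  fixes f :: "'a \<Rightarrow> 'b \<Rightarrow> complex"
  assumes "\<And>i. i \<in> I \<Longrightarrow> (f i has_sum s i) A"
  shows "((\<lambda>x. \<Sum>i\<in>I. f i x) has_sum (\<Sum>i\<in>I. s i)) A"
proof (cases "finite I")
  case True
  from this assms show ?thesis
    by (induction I rule: finite_induct) (simp_all add: has_sum_add)
qed simp

text \<open>With finitely many rows, summability of each row gives summability over pairs without
  further estimates.\<close>

lemma has_sum_finite_Times_UNIV:
  fixes f :: "'a \<times> 'b \<Rightarrow> complex"
  assumes "finite A" "\<And>j. j \<in> A \<Longrightarrow> ((\<lambda>k. f (j, k)) has_sum s j) UNIV"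
  shows "(f has_sum (\<Sum>j\<in>A. s j)) (A \<times> UNIV)"
  using assms
proof (induction A rule: finite_induct)
  case (insert j A)
  have "(f has_sum s j) (range (Pair j))"
    using insert.prems[of j] by (subst has_sum_reindex) (auto simp: o_def inj_on_def)
  moreover have "(f has_sum (\<Sum>j\<in>A. s j)) (A \<times> UNIV)"
    using insert by auto
  ultimately have "(f has_sum s j + (\<Sum>j\<in>A. s j)) (range (Pair j) \<union> A \<times> UNIV)"
    using insert.hyps by (intro has_sum_Un_disjoint) auto
  moreover have "range (Pair j) \<union> A \<times> UNIV = insert j A \<times> (UNIV :: 'b set)" by auto
  ultimately show ?case
    unfolding sum.insert[OF insert.hyps] by (simp only:)
qed simp

subsection \<open>The Weyl pairing as a finite sum\<close>

text \<open>With \<open>x = X + l L\<close>, \<open>y = X - l L\<close> one has \<open>x\<^sup>2 - y\<^sup>2 = 4 l m\<close>, which lies strictly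
  between 0 and 8.\<close>

lemma lattice_point_unique:
  fixes X L :: real and l m :: int
  assumes "1 < X + l * L" "(X + l * L)\<^sup>2 < 8" "\<bar>X - l * L\<bar> < 1" and XL: "X * L = m" and "m \<ge> 1"
  shows "l = 1 \<and> m = 1"
proof -
  let ?x = "X + l * L" and ?y = "X - l * L"
  have diff: "?x\<^sup>2 - ?y\<^sup>2 = 4 * (l * m)"
    unfolding of_int_mult XL[symmetric] by (simp add: power2_eq_square algebra_simps)
  have "?y\<^sup>2 < 1"
    using assms(3) by (simp add: abs_square_less_1)
  moreover have "1 < ?x\<^sup>2"
    using assms(1) by (simp add: one_less_power)
  moreover have "0 \<le> ?y\<^sup>2" by simp
  ultimately have "0 < real_of_int (l * m)" "real_of_int (l * m) < 2"
    using diff assms(2) by linarith+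
  then have "l * m = 1" by linarith
  then show ?thesis
    using \<open>m \<ge> 1\<close> pos_zmult_eq_1_iff[of m l] by (simp add: mult.commute)
qed

text \<open>For \<open>k = T * n\<close> the Wigner function is a Fourier integral of
  \<open>g\<close> at frequency \<open>n / L\<close>. Poisson summation samples \<open>g\<close> at
  multiples of \<open>L\<close>, and \<open>lattice_point_unique\<close> leaves at most the sample
  \<open>l = 1\<close>, present exactly when \<open>T = j\<close>.\<close>

lemma wigner_lattice_has_sum:
  fixes f w :: "real \<Rightarrow> complex"
  assumes f: "twice_cont_diff f" and w: "twice_cont_diff w" and "Q > 0" "T > 0"
    and w0: "\<And>y. \<bar>y\<bar> \<ge> 1 \<Longrightarrow> w y = 0"
    and f0: "\<And>x. x \<le> 1 \<Longrightarrow> f x = 0" "\<And>x. x \<ge> 2 powr (3/2) \<Longrightarrow> f x = 0"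
    and j: "j > 0" and T: "T dvd j"
  shows "((\<lambda>k::int. of_bool (T dvd k) * wigner f w (of_int j / Q, of_int k / Q)) has_sum
           of_real (Q / of_int T) * (if T = j then f (of_int j / Q + Q / of_int j) * w (of_int j / Q - Q / of_int j) else 0)) UNIV"
proof -
  define X where "X = of_int j / Q"
  define L where "L = Q / of_int T"
  define g where "g = (\<lambda>t. f (X + t) * w (X - t))"
  \<comment> \<open>At least 1, so that \<open>l = 1\<close> is in range; and \<open>K * L\<close>
    reaches \<open>X + 1\<close>, beyond which the factor \<open>w\<close> makes \<open>g\<close>
    vanish.\<close>
  define K where "K = nat \<lceil>max 1 ((X + 1) / L)\<rceil>"
  have pos: "X > 0" "L > 0" using assms by (simp_all add: X_def L_def)
  have K: "K \<ge> 1" "X + 1 \<le> real K * L"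
  proof -
    have "max 1 ((X + 1) / L) \<le> real K"
      unfolding K_def by (rule real_nat_ceiling_ge)
    then show "K \<ge> 1" "X + 1 \<le> real K * L"
      using pos by (auto simp: field_simps)
  qed
  have g: "twice_cont_diff g"
    unfolding g_def
    using twice_cont_diff_mult[OF twice_cont_diff_affine[OF f, of X 1] twice_cont_diff_affine[OF w, of X "-1"]]
    by simp
  have g0: "g t = 0" if "\<bar>t\<bar> \<ge> X + 1" for t
    using that pos unfolding g_def by (subst w0) auto
  obtain m where m: "j = T * m" using T by blast
  have "m \<ge> 1" using j \<open>T > 0\<close> m by (metis zero_less_mult_pos int_one_le_iff_zero_less)
  have XL: "X * L = m"
    using \<open>Q > 0\<close> \<open>T > 0\<close> by (simp add: X_def L_def m)
  have zero: "g (of_int l * L) = 0" if "\<not> (l = 1 \<and> m = 1)" for l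
  proof (rule ccontr)
    let ?x = "X + l * L" and ?y = "X - l * L"
    assume "g (of_int l * L) \<noteq> 0"
    then have nz: "f ?x \<noteq> 0" "w ?y \<noteq> 0" by (auto simp: g_def)
    then have x: "1 < ?x" "?x < 2 powr (3/2)" and y: "\<bar>?y\<bar> < 1"
      using f0 w0 by (meson not_le)+
    have "?x\<^sup>2 < (2 powr (3/2))\<^sup>2"
      using x by (intro power_strict_mono) auto
    \<comment> \<open>The right end of the support of \<open>f\<close> is what yields the bound 8,
      hence \<open>l * m < 2\<close>.\<close>
    also have "(2 powr (3/2))\<^sup>2 = (8::real)"
      by (simp add: powr_power)
    finally show False
      using lattice_point_unique[OF x(1) _ y XL \<open>m \<ge> 1\<close>] that by blast
  qed
  have "(\<Sum>l=-int K..int K. g (of_int l * L)) = (\<Sum>l\<in>{1}. g (of_int l * L))"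
    using K(1) zero by (intro sum.mono_neutral_right) auto
  also have "\<dots> = (if m = 1 then g L else 0)"
    using zero[of 1] by auto
  also have "\<dots> = (if T = j then f (of_int j / Q + Q / of_int j) * w (of_int j / Q - Q / of_int j) else 0)"
    using \<open>T > 0\<close> by (auto simp: m g_def X_def L_def)
  finally have sum: "(\<Sum>l=-int K..int K. g (of_int l * L)) = \<dots>" .
  have wig: "(LBINT t. g t * cis (2 * pi * t * (of_int n / L))) = wigner f w (of_int j / Q, of_int (T * n) / Q)" for n :: int
    unfolding wigner_def prod.case
    by (rule Bochner_Integration.integral_cong) (simp_all add: g_def X_def L_def mult_ac)
  have "((\<lambda>n::int. wigner f w (of_int j / Q, of_int (T * n) / Q)) has_sum
      of_real L * (\<Sum>l=-int K..int K. g (of_int l * L))) UNIV"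
    using poisson_summation[OF g g0 pos(2) K(2)] unfolding wig .
  then have "((\<lambda>k::int. wigner f w (of_int j / Q, of_int k / Q)) has_sum
      of_real L * (\<Sum>l=-int K..int K. g (of_int l * L))) (range ((*) T))"
    using \<open>T > 0\<close> by (subst has_sum_reindex) (auto simp: o_def inj_on_def)
  \<comment> \<open>The indicator extends the sum from multiples of \<open>T\<close> to all integers
    by zeros.\<close>
  also have "?this \<longleftrightarrow> ((\<lambda>k::int. of_bool (T dvd k) * wigner f w (of_int j / Q, of_int k / Q)) has_sum
      of_real L * (\<Sum>l=-int K..int K. g (of_int l * L))) UNIV"
    by (rule has_sum_cong_neutral) auto
  finally show ?thesis
    unfolding sum unfolding L_def .
qed

lemma wigner_row_has_sum:
  fixes f w :: "real \<Rightarrow> complex"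
  assumes f: "twice_cont_diff f" and w: "twice_cont_diff w" and "Q > 0"
    and w0: "\<And>y. \<bar>y\<bar> \<ge> 1 \<Longrightarrow> w y = 0"
    and f0: "\<And>x. x \<le> 1 \<Longrightarrow> f x = 0" "\<And>x. x \<ge> 2 powr (3/2) \<Longrightarrow> f x = 0"
    and j: "j > 0"
  shows "((\<lambda>k::int. of_int (a' (gcd j k)) * wigner f w (of_int j / Q, of_int k / Q)) has_sum
           of_real Q * (moebius_odd j * (f (of_int j / Q + Q / of_int j) * w (of_int j / Q - Q / of_int j)))) UNIV"
proof -
  let ?P = "odd_prime_divisors j"
  let ?W = "\<lambda>k::int. wigner f w (of_int j / Q, of_int k / Q)"
  define z where "z = f (of_int j / Q + Q / of_int j) * w (of_int j / Q - Q / of_int j)"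
  have fin: "finite ?P" using j by (intro finite_odd_prime_divisors) auto
  have summand: "((\<lambda>k::int. of_int ((-1) ^ card S * \<Prod>S) * (of_bool (\<Prod>S dvd k) * ?W k)) has_sum
      of_real Q * ((-1) ^ card S * (if \<Prod>S = j then z else 0))) UNIV" if S: "S \<in> Pow ?P" for S
  proof -
    have "\<Prod>S > 0"
      using S by (intro prod_pos) (auto simp: odd_prime_divisors_def prime_gt_0_int)
    moreover have "\<Prod>S dvd j"
      using S fin finite_subset by (subst prod_primes_dvd_iff) (auto simp: odd_prime_divisors_def)
    ultimately have "((\<lambda>k. of_int ((-1) ^ card S * \<Prod>S) * (of_bool (\<Prod>S dvd k) * ?W k)) has_sum
        of_int ((-1) ^ card S * \<Prod>S) * (of_real (Q / of_int (\<Prod>S)) * (if \<Prod>S = j then z else 0))) UNIV"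
      unfolding z_def
      by (intro has_sum_cmult_right wigner_lattice_has_sum[OF f w \<open>Q > 0\<close> _ w0 f0 j]) auto
    \<comment> \<open>The weight \<open>\<Prod>S\<close> from \<open>a'\<close> cancels the divisor
      in the dual spacing \<open>Q / \<Prod>S\<close>, so the same factor \<open>Q\<close> remains
      for every \<open>S\<close>.\<close>
    also have "of_int ((-1) ^ card S * \<Prod>S) * (of_real (Q / of_int (\<Prod>S)) * (if \<Prod>S = j then z else 0))
        = of_real Q * ((-1) ^ card S * (if \<Prod>S = j then z else 0))"
      using \<open>\<Prod>S > 0\<close> by (simp del: of_int_prod)
    finally show ?thesis .
  qed
  have "((\<lambda>k::int. \<Sum>S\<in>Pow ?P. of_int ((-1) ^ card S * \<Prod>S) * (of_bool (\<Prod>S dvd k) * ?W k)) has_sum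
      (\<Sum>S\<in>Pow ?P. of_real Q * ((-1) ^ card S * (if \<Prod>S = j then z else 0)))) UNIV"
    by (rule has_sum_sum) (rule summand)
  also have "(\<lambda>k. \<Sum>S\<in>Pow ?P. of_int ((-1) ^ card S * \<Prod>S) * (of_bool (\<Prod>S dvd k) * ?W k)) =
      (\<lambda>k. of_int (a' (gcd j k)) * ?W k)"
    using j by (simp add: a'_gcd sum_distrib_right mult.assoc)
  also have "(\<Sum>S\<in>Pow ?P. of_real Q * ((-1) ^ card S * (if \<Prod>S = j then z else 0))) =
      of_real Q * (moebius_odd j * z)"
    using j by (subst sum_distrib_left[symmetric]) (subst sum_subsets_odd_prime_divisors, auto)
  finally show ?thesis unfolding z_def .
qed

text \<open>Adding \<open>1 < X + t < 3\<close> and \<open>\<bar>X - t\<bar> < 1\<close> gives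
  \<open>0 < X < 2\<close> for \<open>X = j / Q\<close>, so all rows outside \<open>1..2 * Q\<close>
  vanish. The factor \<open>Q\<close> of each remaining row cancels the \<open>1 / Q\<close> in
  \<open>dilate\<close>.\<close>

lemma Psi_dilate_T_inf_half:
  fixes v w :: "real \<Rightarrow> complex"
  assumes v: "twice_cont_diff v" and w: "twice_cont_diff w" and "Q > 0"
    and w0: "\<And>y. \<bar>y\<bar> \<ge> 1 \<Longrightarrow> w y = 0"
    and v0: "\<And>x. x \<le> 1 \<Longrightarrow> v x = 0" "\<And>x. x \<ge> 2 powr (3/2) \<Longrightarrow> v x = 0"
  shows "sesq v (Psi (dilate (real Q) T_inf_half) w) =
           (\<Sum>j\<in>{1..2 * int Q}. moebius_odd j * (cnj (v (of_int j / Q + Q / of_int j)) * w (of_int j / Q - Q / of_int j)))"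
proof -
  define f where "f = (\<lambda>x. cnj (v x))"
  define A where "A = {1..2 * int Q}"
  let ?F = "\<lambda>(j, k). of_int (a' (gcd j k)) * wigner f w (of_int j / Q, of_int k / Q)"
  have "(?F has_sum (\<Sum>j\<in>A. of_real (real Q) * (moebius_odd j *
      (f (of_int j / Q + Q / of_int j) * w (of_int j / Q - Q / of_int j))))) (A \<times> (UNIV :: int set))"
  proof (rule has_sum_finite_Times_UNIV)
    fix j assume "j \<in> A"
    then have "j > 0" by (simp add: A_def)
    have "twice_cont_diff f" unfolding f_def by (intro twice_cont_diff_cnj v)
    then show "((\<lambda>k. ?F (j, k)) has_sum of_real (real Q) * (moebius_odd j *
      (f (of_int j / Q + Q / of_int j) * w (of_int j / Q - Q / of_int j)))) UNIV"
      unfolding prod.case using \<open>Q > 0\<close> \<open>j > 0\<close> w w0 v0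
      by (intro wigner_row_has_sum) (auto simp: f_def)
  qed (simp add: A_def)
  also have "?this \<longleftrightarrow> (?F has_sum (\<Sum>j\<in>A. of_real (real Q) * (moebius_odd j *
      (f (of_int j / Q + Q / of_int j) * w (of_int j / Q - Q / of_int j))))) (UNIV - {(0, 0)})"
  proof (rule has_sum_cong_neutral)
    fix x :: "int \<times> int" assume x: "x \<in> (UNIV - {(0, 0)}) - A \<times> UNIV"
    obtain j k where jk: "x = (j, k)" by fastforce
    with x have j: "j < 1 \<or> j > 2 * int Q" by (auto simp: A_def)
    define X where "X = of_int j / real Q"
    have X: "X \<le> 0 \<or> X \<ge> 2"
    proof (cases "j < 1")
      case True
      then have "X \<le> 0" using \<open>Q > 0\<close> by (simp add: X_def divide_nonpos_pos)
      then show ?thesis ..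
    next
      case False
      with j have "2 * real Q \<le> of_int j" by linarith
      then show ?thesis using \<open>Q > 0\<close> by (simp add: X_def field_simps)
    qed
    have lt3: "2 powr (3/2) < (3::real)"
    proof (rule power2_less_imp_less)
      show "(2 powr (3/2))\<^sup>2 < (3::real)\<^sup>2" by (simp add: powr_power)
    qed simp
    have "f (X + t) * w (X - t) = 0" for t
    proof (rule ccontr)
      assume "f (X + t) * w (X - t) \<noteq> 0"
      then have "f (X + t) \<noteq> 0" "w (X - t) \<noteq> 0" by auto
      then have "1 < X + t" "X + t < 2 powr (3/2)" "\<bar>X - t\<bar> < 1"
        using v0 w0 unfolding f_def by (metis complex_cnj_zero not_le)+
      with X lt3 show False by linarith
    qed
    then have "f (X + t) * cis s * w (X - t) = 0" for t s
      by (metis mult_eq_0_iff)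
    then have "wigner f w (X, \<xi>) = 0" for \<xi>
      unfolding wigner_def prod.case by (simp only: Bochner_Integration.integral_zero)
    then show "?F x = 0"
      by (simp add: jk flip: X_def)
  next
    fix x :: "int \<times> int" assume "x \<in> A \<times> UNIV - (UNIV - {(0, 0)})"
    then show "?F x = 0" by (auto simp: A_def)
  qed auto
  finally have "infsum ?F (UNIV - {(0, 0)}) = (\<Sum>j\<in>A. of_real (real Q) * (moebius_odd j *
      (f (of_int j / Q + Q / of_int j) * w (of_int j / Q - Q / of_int j))))"
    by (rule infsumI)
  then show ?thesis
    using \<open>Q > 0\<close>
    by (simp add: sesq_def Psi_def dilate_def T_inf_half_def f_def A_def flip: sum_distrib_left)
qed

subsection \<open>Estimates\<close>

text \<open>Each integration from \<open>a\<close> gains one power of \<open>x - a\<close>. The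
  bound for one derivative rests on that for the next, so the induction generalises over
  \<open>j\<close>.\<close>

lemma flat_point_bound:
  assumes "smooth v" and "\<And>j. vderiv j v a = 0"
  shows "\<exists>C\<ge>0. \<forall>x\<in>{a..b}. norm (vderiv j v x) \<le> C * (x - a) ^ n"
proof (induction n arbitrary: j)
  case 0
  have "bounded (vderiv j v ` {a..b})"
    by (intro compact_imp_bounded compact_continuous_image continuous_on_vderiv assms compact_Icc)
  then obtain C where "C > 0" "\<forall>x\<in>vderiv j v ` {a..b}. norm x \<le> C"
    unfolding bounded_pos by blast
  then show ?case by (intro exI[of _ C]) auto
next
  case (Suc n)
  obtain C where C: "C \<ge> 0" "\<And>x. x \<in> {a..b} \<Longrightarrow> norm (vderiv (Suc j) v x) \<le> C * (x - a) ^ n"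
    using Suc.IH[of "Suc j"] by blast
  have "norm (vderiv j v x) \<le> C * (x - a) ^ Suc n" if x: "x \<in> {a..b}" for x
  proof -
    have "(vderiv (Suc j) v has_integral (vderiv j v x - vderiv j v a)) {a..x}"
      using x by (intro fundamental_theorem_of_calculus
          has_vector_derivative_at_within[OF vderiv_has_vector_derivative[OF assms(1)]]) auto
    then have "vderiv j v x = integral {a..x} (vderiv (Suc j) v)"
      by (simp add: assms(2) integral_unique)
    also have "norm \<dots> \<le> C * (x - a) ^ n * (x - a)"
    proof (rule integral_bound)
      fix t assume t: "t \<in> {a..x}"
      then have "norm (vderiv (Suc j) v t) \<le> C * (t - a) ^ n" using x by (intro C) auto
      also have "\<dots> \<le> C * (x - a) ^ n"
        using t C(1) by (intro mult_left_mono power_mono) auto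
      finally show "norm (vderiv (Suc j) v t) \<le> C * (x - a) ^ n" .
    qed (use x in \<open>auto intro: continuous_on_vderiv assms\<close>)
    finally show ?thesis by (simp add: mult_ac)
  qed
  with C(1) show ?case by blast
qed

text \<open>Continuity adds the endpoints to the zero set; this supplies the strict inequalities
  required by \<open>lattice_point_unique\<close>.\<close>

lemma supp_Icc_imp_zero:
  assumes "continuous_on UNIV f" "supp f \<subseteq> {a..b}" "x \<le> a \<or> x \<ge> b"
  shows "f x = 0"
proof -
  have "f y = 0" if "y < a \<or> y > b" for y
    using assms(2) that closure_subset[of "{x. f x \<noteq> 0}"] by (force simp: supp_def)
  then have sub: "{..<a} \<subseteq> {x. f x = 0}" "{b<..} \<subseteq> {x. f x = 0}" by auto
  have "closed {x. f x = 0}"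
    using assms(1) by (intro closed_Collect_eq) auto
  then have "closure {..<a} \<subseteq> {x. f x = 0}" "closure {b<..} \<subseteq> {x. f x = 0}"
    using sub closure_minimal by blast+
  then show ?thesis using assms(3) by auto
qed

lemma bounded_if_zero_outside_Icc:
  fixes f :: "real \<Rightarrow> complex"
  assumes "continuous_on UNIV f" "\<And>x. x \<le> a \<or> x \<ge> b \<Longrightarrow> f x = 0"
  obtains B where "B \<ge> 0" "\<And>x. norm (f x) \<le> B"
proof -
  have "bounded (f ` {a..b})"
    using assms(1) by (intro compact_imp_bounded compact_continuous_image compact_Icc)
      (auto intro: continuous_on_subset)
  then obtain B where B: "B > 0" "\<And>x. x \<in> {a..b} \<Longrightarrow> norm (f x) \<le> B"
    unfolding bounded_pos by blast
  have "norm (f x) \<le> B" for x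
    using B assms(2)[of x] by (cases "x \<in> {a..b}") auto
  with B(1) show ?thesis by (intro that[of B]) auto
qed

lemma rescale_0: "Q > 0 \<Longrightarrow> rescale 0 u Q = u"
  by (simp add: rescale_def)

lemma tendsto_rescale:
  assumes "continuous_on UNIV u" "Q > 0"
  shows "((\<lambda>\<epsilon>. rescale \<epsilon> u Q y) \<longlongrightarrow> u y) (at_right 0)"
proof -
  \<comment> \<open>The divisor \<open>c\<close> serves both exponents, \<open>\<epsilon>\<close>
    and \<open>\<epsilon> / 2\<close>.\<close>
  have powr: "((\<lambda>\<epsilon>. real Q powr (\<epsilon> / c)) \<longlongrightarrow> real Q powr (0 / c)) (at_right 0)" if "c \<noteq> 0" for c
    using \<open>Q > 0\<close> that by (intro tendsto_intros) auto
  have "((\<lambda>\<epsilon>. real Q powr \<epsilon> * y) \<longlongrightarrow> y) (at_right 0)"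
    using tendsto_mult_right[OF powr[of 1], of y] \<open>Q > 0\<close> by simp
  moreover have "isCont u y"
    using assms(1) by (simp add: continuous_on_eq_continuous_at)
  ultimately have u: "((\<lambda>\<epsilon>. u (real Q powr \<epsilon> * y)) \<longlongrightarrow> u y) (at_right 0)"
    by (rule isCont_tendsto_compose[rotated])
  have "((\<lambda>\<epsilon>. rescale \<epsilon> u Q y) \<longlongrightarrow> of_real (real Q powr (0 / 2)) * u y) (at_right 0)"
    unfolding rescale_def by (intro tendsto_mult tendsto_of_real powr u) simp
  then show ?thesis using \<open>Q > 0\<close> by simp
qed

section \<open>Bounds for the terms of the Dirichlet series\<close>

context
  fixes v u :: "real \<Rightarrow> complex"
  assumes v: "smooth v" and u: "smooth u"
    and supp_v: "supp v \<subseteq> {1..2 powr (3/2)}" and supp_u: "supp u \<subseteq> {-1..1}"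
begin

lemma v_eq_0: "x \<le> 1 \<Longrightarrow> v x = 0" "x \<ge> 2 powr (3/2) \<Longrightarrow> v x = 0"
  using supp_Icc_imp_zero[OF _ supp_v] continuous_on_vderiv[OF v, of UNIV 0] by auto

lemma u_eq_0: "\<bar>y\<bar> \<ge> 1 \<Longrightarrow> u y = 0"
  using supp_Icc_imp_zero[OF _ supp_u, of y] continuous_on_vderiv[OF u, of UNIV 0]
  by (cases "y \<ge> 0") auto

lemma rescale_eq_0:
  assumes "real Q powr (-\<epsilon>) \<le> \<bar>y\<bar>" "Q > 0"
  shows "rescale \<epsilon> u Q y = 0"
proof -
  have "1 \<le> \<bar>y\<bar> * real Q powr \<epsilon>"
    using assms by (simp add: powr_minus field_simps)
  also have "\<dots> = \<bar>real Q powr \<epsilon> * y\<bar>"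
    by (simp add: abs_mult)
  finally show ?thesis by (simp add: rescale_def u_eq_0)
qed

text \<open>For \<open>\<epsilon> \<ge> 0\<close> and \<open>Q \<ge> 1\<close> rescaling does not
  enlarge the support of \<open>u\<close>, so the finite formula applies. The case
  \<open>\<epsilon> = 0\<close> is included to cover \<open>F_zero\<close>.\<close>

lemma F_term_eq:
  assumes "\<epsilon> \<ge> 0" "Q > 0"
  shows "F_term v (rescale \<epsilon> u) s Q = of_nat Q powr (-s) *
    (\<Sum>j\<in>{1..2 * int Q}. moebius_odd j *
       (cnj (v (of_int j / Q + Q / of_int j)) * rescale \<epsilon> u Q (of_int j / Q - Q / of_int j)))"
proof -
  have "twice_cont_diff (rescale \<epsilon> u Q)"
    unfolding rescale_def
    using twice_cont_diff_mult[OF twice_cont_diff_const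
        twice_cont_diff_affine[OF smooth_imp_twice_cont_diff[OF u], of 0]] by simp
  moreover have "rescale \<epsilon> u Q y = 0" if "\<bar>y\<bar> \<ge> 1" for y
  proof (rule rescale_eq_0[OF _ \<open>Q > 0\<close>])
    have "real Q powr (-\<epsilon>) \<le> real Q powr 0"
      using assms by (intro powr_mono) auto
    then show "real Q powr (-\<epsilon>) \<le> \<bar>y\<bar>" using that assms by simp
  qed
  ultimately show ?thesis
    unfolding F_term_def
    using Psi_dilate_T_inf_half[OF smooth_imp_twice_cont_diff[OF v], of "rescale \<epsilon> u Q" Q] v_eq_0 \<open>Q > 0\<close>
    by simp
qed

text \<open>There are \<open>2 * Q\<close> values of \<open>j\<close>, each contributing at most
  \<open>C * Q powr (\<epsilon> / 2)\<close>. Leaving \<open>C\<close> open lets the trivial bound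
  and the flatness bound share the argument.\<close>

lemma norm_F_term_le:
  assumes "\<epsilon> \<ge> 0" "Q > 0"
    and bound: "\<And>j. j \<ge> 1 \<Longrightarrow> norm (v (of_int j / Q + Q / of_int j)) *
       norm (u (real Q powr \<epsilon> * (of_int j / Q - Q / of_int j))) \<le> C"
  shows "norm (F_term v (rescale \<epsilon> u) s Q) \<le> 2 * C * real Q powr (1 + \<epsilon> / 2 - Re s)"
proof -
  have "norm (\<Sum>j\<in>{1..2 * int Q}. moebius_odd j *
       (cnj (v (of_int j / Q + Q / of_int j)) * rescale \<epsilon> u Q (of_int j / Q - Q / of_int j)))
     \<le> (\<Sum>j\<in>{1..2 * int Q}. real Q powr (\<epsilon> / 2) * C)"
  proof (rule sum_norm_le)
    fix j assume j: "j \<in> {1..2 * int Q}"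
    let ?n = "norm (v (of_int j / Q + Q / of_int j)) *
       norm (u (real Q powr \<epsilon> * (of_int j / Q - Q / of_int j)))"
    have "norm (moebius_odd j * (cnj (v (of_int j / Q + Q / of_int j)) * rescale \<epsilon> u Q (of_int j / Q - Q / of_int j)))
       = norm (moebius_odd j) * (real Q powr (\<epsilon> / 2) * ?n)"
      by (simp add: rescale_def norm_mult mult_ac)
    also have "\<dots> \<le> 1 * (real Q powr (\<epsilon> / 2) * C)"
      using bound[of j] j by (intro mult_mono norm_moebius_odd_le mult_left_mono) auto
    finally show "norm (moebius_odd j * (cnj (v (of_int j / Q + Q / of_int j)) *
        rescale \<epsilon> u Q (of_int j / Q - Q / of_int j))) \<le> real Q powr (\<epsilon> / 2) * C" by simp
  qed
  also have "\<dots> = 2 * C * (real Q powr 1 * real Q powr (\<epsilon> / 2))"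
    using \<open>Q > 0\<close> by simp
  finally have "norm (F_term v (rescale \<epsilon> u) s Q) \<le>
     norm (of_nat Q powr (-s)) * (2 * C * (real Q powr 1 * real Q powr (\<epsilon> / 2)))"
    unfolding F_term_eq[OF assms(1,2)] norm_mult by (rule mult_left_mono) simp
  also have "norm (of_nat Q powr (-s) :: complex) = real Q powr (- Re s)"
    using \<open>Q > 0\<close> norm_powr_real_powr[of "of_nat Q" "-s"] by simp
  also have "real Q powr (- Re s) * (2 * C * (real Q powr 1 * real Q powr (\<epsilon> / 2))) =
     2 * C * (real Q powr (- Re s) * (real Q powr 1 * real Q powr (\<epsilon> / 2)))"
    by (simp only: mult_ac)
  also have "\<dots> = 2 * C * real Q powr (1 + \<epsilon> / 2 - Re s)"
    unfolding powr_add[symmetric] by (simp add: algebra_simps)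
  finally show ?thesis .
qed

text \<open>Boundedness of \<open>v\<close> and \<open>u\<close> suffices. The constant is
  independent of \<open>\<epsilon>\<close>, \<open>Q\<close> and \<open>s\<close>, as dominated
  convergence requires.\<close>

lemma F_term_bound:
  obtains C where "C \<ge> 0"
    "\<And>\<epsilon> Q s. \<epsilon> \<ge> 0 \<Longrightarrow> Q > 0 \<Longrightarrow>
       norm (F_term v (rescale \<epsilon> u) s Q) \<le> C * real Q powr (1 + \<epsilon> / 2 - Re s)"
proof -
  obtain B where B: "B \<ge> 0" "\<And>x. norm (v x) \<le> B"
    by (rule bounded_if_zero_outside_Icc[of v 1 "2 powr (3/2)"])
      (use v_eq_0 continuous_on_vderiv[OF v, of UNIV 0] in auto)
  obtain D where D: "D \<ge> 0" "\<And>x. norm (u x) \<le> D"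
    by (rule bounded_if_zero_outside_Icc[of u "-1" 1])
      (use u_eq_0 continuous_on_vderiv[OF u, of UNIV 0] in auto)
  have "norm (F_term v (rescale \<epsilon> u) s Q) \<le> 2 * (B * D) * real Q powr (1 + \<epsilon> / 2 - Re s)"
    if "\<epsilon> \<ge> 0" "Q > 0" for \<epsilon> Q s
    by (rule norm_F_term_le[OF that]) (intro mult_mono B D norm_ge_zero)
  then show ?thesis using B D by (intro that[of "2 * (B * D)"]) auto
qed

text \<open>The factor \<open>u\<close> forces \<open>\<bar>y\<bar> \<le> Q powr (-\<epsilon>)\<close> and \<open>x\<^sup>2 = 4 + y\<^sup>2\<close> puts \<open>x\<close> within
  \<open>Q powr (-2 * \<epsilon>)\<close> of the point 2, where \<open>v\<close> vanishes to infinite order.\<close>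

lemma F_term_rapid_decay:
  assumes flat: "\<And>j. vderiv j v 2 = 0" and "\<epsilon> > 0"
  obtains C where "C \<ge> 0"
    "\<And>Q s. Q > 0 \<Longrightarrow> Re s \<ge> \<sigma> \<Longrightarrow> norm (F_term v (rescale \<epsilon> u) s Q) \<le> C * real Q powr (-2)"
proof -
  obtain D where D: "D \<ge> 0" "\<And>x. norm (u x) \<le> D"
    by (rule bounded_if_zero_outside_Icc[of u "-1" 1])
      (use u_eq_0 continuous_on_vderiv[OF u, of UNIV 0] in auto)
  \<comment> \<open>Chosen so that the exponent
    \<open>-2 * \<epsilon> * N + 1 + \<epsilon> / 2 - \<sigma>\<close> is at most -2.\<close>
  obtain N :: nat where N: "(3 + \<epsilon> / 2 - \<sigma>) / (2 * \<epsilon>) \<le> real N"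
    using real_arch_simple by blast
  obtain C where C: "C \<ge> 0" "\<And>x. x \<in> {2..3} \<Longrightarrow> norm (v x) \<le> C * (x - 2) ^ N"
    using flat_point_bound[OF v flat, of 3 0 N] by auto
  have "norm (F_term v (rescale \<epsilon> u) s Q) \<le> 2 * (C * D) * real Q powr (-2)"
    if Q: "Q > 0" and s: "Re s \<ge> \<sigma>" for Q s
  proof -
    have "norm (F_term v (rescale \<epsilon> u) s Q) \<le>
        2 * (C * (real Q powr (-2 * \<epsilon>)) ^ N * D) * real Q powr (1 + \<epsilon> / 2 - Re s)"
    proof (rule norm_F_term_le[OF less_imp_le[OF \<open>\<epsilon> > 0\<close>] Q])
      fix j :: int assume "j \<ge> 1"
      define x where "x = of_int j / Q + Q / of_int j"
      define y where "y = of_int j / Q - Q / of_int j"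
      have nonneg: "0 \<le> C * (real Q powr (-2 * \<epsilon>)) ^ N * D" using C D by simp
      have "norm (v x) * norm (u (real Q powr \<epsilon> * y)) \<le> C * (real Q powr (-2 * \<epsilon>)) ^ N * D"
      proof (cases "v x = 0 \<or> u (real Q powr \<epsilon> * y) = 0")
        case False
        have "x > 0" using \<open>j \<ge> 1\<close> Q by (simp add: x_def add_pos_pos)
        have xy: "x\<^sup>2 = 4 + y\<^sup>2"
          using \<open>j \<ge> 1\<close> Q by (simp add: x_def y_def power2_eq_square field_simps)
        then have "2\<^sup>2 \<le> x\<^sup>2" by simp
        then have "2 \<le> x" using \<open>x > 0\<close> by (intro power2_le_imp_le[OF \<open>2\<^sup>2 \<le> x\<^sup>2\<close>]) simp 
        have "x < 2 powr (3/2)" using False v_eq_0(2) by (meson not_le)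
        then have "x\<^sup>2 < (2 powr (3/2))\<^sup>2" using \<open>x > 0\<close> by (intro power_strict_mono) auto
        also have "(2 powr (3/2))\<^sup>2 \<le> (3::real)\<^sup>2" by (simp add: powr_power)
        finally have "x < 3" by (rule power2_less_imp_less) simp
        have "rescale \<epsilon> u Q y \<noteq> 0" using False Q by (simp add: rescale_def)
        then have "\<bar>y\<bar> \<le> real Q powr (-\<epsilon>)" using rescale_eq_0[OF _ Q] by (meson le_cases)
        then have "\<bar>y\<bar>\<^sup>2 \<le> (real Q powr (-\<epsilon>))\<^sup>2" by (intro power_mono) auto
        also have "(real Q powr (-\<epsilon>))\<^sup>2 = real Q powr (-2 * \<epsilon>)"
          using Q by (simp add: powr_power)
        finally have y: "y\<^sup>2 \<le> real Q powr (-2 * \<epsilon>)" by simp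
        \<comment> \<open>Since \<open>x + 2 \<ge> 1\<close>, the distance \<open>x - 2\<close> is
          at most \<open>(x - 2) * (x + 2)\<close>, which is \<open>y\<close> squared.\<close>
        have "(x - 2) * 1 \<le> (x - 2) * (x + 2)"
          using \<open>2 \<le> x\<close> by (intro mult_left_mono) auto
        also have "\<dots> = y\<^sup>2" using xy by (simp add: power2_eq_square algebra_simps)
        finally have "x - 2 \<le> real Q powr (-2 * \<epsilon>)" using y by simp
        then have "C * (x - 2) ^ N \<le> C * (real Q powr (-2 * \<epsilon>)) ^ N"
          using \<open>2 \<le> x\<close> C by (intro mult_left_mono power_mono) auto
        moreover have "norm (v x) \<le> C * (x - 2) ^ N"
          using \<open>2 \<le> x\<close> \<open>x < 3\<close> by (intro C) auto
        ultimately have "norm (v x) \<le> C * (real Q powr (-2 * \<epsilon>)) ^ N" by simp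
        then show ?thesis using C D by (intro mult_mono) auto
      qed (use nonneg in auto)
      then show "norm (v (of_int j / Q + Q / of_int j)) *
       norm (u (real Q powr \<epsilon> * (of_int j / Q - Q / of_int j))) \<le> C * (real Q powr (-2 * \<epsilon>)) ^ N * D"
        unfolding x_def y_def .
    qed
    also have "(real Q powr (-2 * \<epsilon>)) ^ N = real Q powr (-2 * \<epsilon> * real N)"
      using Q by (simp add: powr_power mult_ac)
    also have "2 * (C * real Q powr (-2 * \<epsilon> * real N) * D) * real Q powr (1 + \<epsilon> / 2 - Re s) =
        2 * (C * D) * (real Q powr (-2 * \<epsilon> * real N) * real Q powr (1 + \<epsilon> / 2 - Re s))"
      by (simp only: mult_ac)
    also have "\<dots> = 2 * (C * D) * real Q powr (-2 * \<epsilon> * real N + (1 + \<epsilon> / 2 - Re s))"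
      by (simp only: powr_add)
    also have "\<dots> \<le> 2 * (C * D) * real Q powr (-2)"
    proof (intro mult_left_mono powr_mono)
      have "3 + \<epsilon> / 2 - \<sigma> \<le> real N * (2 * \<epsilon>)"
        using N \<open>\<epsilon> > 0\<close> by (simp add: pos_divide_le_eq)
      then show "-2 * \<epsilon> * real N + (1 + \<epsilon> / 2 - Re s) \<le> -2"
        using s by (simp add: mult_ac)
    qed (use Q C D in auto)
    finally show ?thesis .
  qed
  then show ?thesis using C D by (intro that[of "2 * (C * D)"]) auto
qed

section \<open>Entire continuation\<close>

lemma F_term_holomorphic: "Q > 0 \<Longrightarrow> (\<lambda>s. F_term v w s Q) holomorphic_on A"
  unfolding F_term_def by (intro holomorphic_intros) auto

text \<open>On every half-plane \<open>Re s \<ge> \<sigma>\<close> the terms have a summable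
  majorant independent of \<open>s\<close>, so the finite sums, which are holomorphic, converge
  uniformly on a disc around any point.\<close>

lemma F_eps_summable_and_entire:
  assumes flat: "\<And>j. vderiv j v 2 = 0" and "\<epsilon> > 0"
  shows "F_term v (rescale \<epsilon> u) s summable_on Sq_odd" "F_eps \<epsilon> v u holomorphic_on UNIV"
proof -
  have pos: "Q > 0" if "Q \<in> Sq_odd" for Q using that by (simp add: Sq_odd_def)
  have summ: "(\<lambda>Q. C * real Q powr (-2)) summable_on Sq_odd" for C
  proof (rule summable_on_cmult_right)
    have "(\<lambda>Q::nat. real Q powr (-2)) summable_on UNIV"
      by (rule norm_summable_imp_summable_on) (simp add: summable_real_powr_iff)
    then show "(\<lambda>Q. real Q powr (-2)) summable_on Sq_odd"
      by (rule summable_on_subset_banach) simp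
  qed
  show "F_term v (rescale \<epsilon> u) s summable_on Sq_odd"
  proof -
    obtain C where C: "C \<ge> 0" "\<And>Q s'. Q > 0 \<Longrightarrow> Re s' \<ge> Re s \<Longrightarrow>
        norm (F_term v (rescale \<epsilon> u) s' Q) \<le> C * real Q powr (-2)"
      by (rule F_term_rapid_decay[OF flat \<open>\<epsilon> > 0\<close>, of "Re s"]) blast
    have "(\<lambda>Q. norm (F_term v (rescale \<epsilon> u) s Q)) summable_on Sq_odd"
      by (rule Infinite_Sum.abs_summable_on_comparison_test'[OF summ[of C]]) (simp add: C pos)
    then show ?thesis by (rule abs_summable_summable)
  qed
  have "\<exists>e>0. F_eps \<epsilon> v u holomorphic_on ball z e" for z
  proof -
    obtain C where C: "C \<ge> 0" "\<And>Q s. Q > 0 \<Longrightarrow> Re s \<ge> Re z - 1 \<Longrightarrow>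
        norm (F_term v (rescale \<epsilon> u) s Q) \<le> C * real Q powr (-2)"
      by (rule F_term_rapid_decay[OF flat \<open>\<epsilon> > 0\<close>, of "Re z - 1"]) blast
    \<comment> \<open>The closed unit disc lies in this half-plane, so one constant \<open>C\<close>
      serves all of it.\<close>
    have "Re s \<ge> Re z - 1" if "s \<in> cball z 1" for s
      using that abs_Re_le_cmod[of "z - s"] by (simp add: dist_norm)
    then have "uniform_limit (cball z 1) (\<lambda>X s. \<Sum>Q\<in>X. F_term v (rescale \<epsilon> u) s Q)
        (\<lambda>s. \<Sum>\<^sub>\<infinity>Q\<in>Sq_odd. F_term v (rescale \<epsilon> u) s Q) (finite_subsets_at_top Sq_odd)"
      by (intro Weierstrass_m_test_general[OF _ summ[of C]] C pos) auto
    moreover have "\<forall>\<^sub>F X in finite_subsets_at_top Sq_odd.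
        continuous_on (cball z 1) (\<lambda>s. \<Sum>Q\<in>X. F_term v (rescale \<epsilon> u) s Q) \<and>
        (\<lambda>s. \<Sum>Q\<in>X. F_term v (rescale \<epsilon> u) s Q) holomorphic_on ball z 1"
    proof (rule eventually_finite_subsets_at_top_weakI)
      fix X assume "X \<subseteq> Sq_odd"
      then have "(\<lambda>s. \<Sum>Q\<in>X. F_term v (rescale \<epsilon> u) s Q) holomorphic_on A" for A
        using pos by (intro holomorphic_on_sum F_term_holomorphic) auto
      then show "continuous_on (cball z 1) (\<lambda>s. \<Sum>Q\<in>X. F_term v (rescale \<epsilon> u) s Q) \<and>
        (\<lambda>s. \<Sum>Q\<in>X. F_term v (rescale \<epsilon> u) s Q) holomorphic_on ball z 1"
        by (simp add: holomorphic_on_imp_continuous_on)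
    qed
    ultimately have "(\<lambda>s. \<Sum>\<^sub>\<infinity>Q\<in>Sq_odd. F_term v (rescale \<epsilon> u) s Q) holomorphic_on ball z 1"
      using holomorphic_uniform_limit[of z 1] by (metis finite_subsets_at_top_neq_bot)
    then have "F_eps \<epsilon> v u holomorphic_on ball z 1"
      by (simp add: F_eps_def[abs_def])
    then show ?thesis by (intro exI[of _ 1]) simp
  qed
  then have "F_eps \<epsilon> v u analytic_on UNIV"
    unfolding analytic_on_def by blast
  then show "F_eps \<epsilon> v u holomorphic_on UNIV"
    by (rule analytic_imp_holomorphic)
qed

section \<open>The limit of vanishing scaling exponent\<close>

text \<open>Makes the unscaled series the member \<open>\<epsilon> = 0\<close> of the family, so
  that the same bounds apply to it.\<close>

lemma F_term_v_u_eq: "Q > 0 \<Longrightarrow> F_term v (\<lambda>_. u) s Q = F_term v (rescale 0 u) s Q"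
  by (simp add: F_term_def rescale_0)

text \<open>For fixed \<open>Q\<close> the range of \<open>j\<close> does not depend on
  \<open>\<epsilon>\<close>, so the limit is taken inside a finite sum.\<close>

lemma tendsto_F_term:
  assumes "Q > 0"
  shows "((\<lambda>\<epsilon>. F_term v (rescale \<epsilon> u) s Q) \<longlongrightarrow> F_term v (\<lambda>_. u) s Q) (at_right 0)"
proof -
  let ?S = "\<lambda>\<epsilon>. of_nat Q powr (-s) * (\<Sum>j\<in>{1..2 * int Q}. moebius_odd j *
       (cnj (v (of_int j / Q + Q / of_int j)) * rescale \<epsilon> u Q (of_int j / Q - Q / of_int j)))"
  have "(?S \<longlongrightarrow> of_nat Q powr (-s) * (\<Sum>j\<in>{1..2 * int Q}. moebius_odd j *
       (cnj (v (of_int j / Q + Q / of_int j)) * u (of_int j / Q - Q / of_int j)))) (at_right 0)"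
    using continuous_on_vderiv[OF u, of UNIV 0] assms
    by (intro tendsto_mult_left tendsto_sum tendsto_rescale) auto
  also have "of_nat Q powr (-s) * (\<Sum>j\<in>{1..2 * int Q}. moebius_odd j *
       (cnj (v (of_int j / Q + Q / of_int j)) * u (of_int j / Q - Q / of_int j))) =
     F_term v (\<lambda>_. u) s Q"
    using F_term_eq[of 0 Q s] assms by (simp add: F_term_v_u_eq rescale_0)
  finally show ?thesis
  proof (rule Lim_transform_eventually)
    show "\<forall>\<^sub>F \<epsilon> in at_right 0. ?S \<epsilon> = F_term v (rescale \<epsilon> u) s Q"
      using eventually_at_right_less[of 0]
      by eventually_elim (rule F_term_eq[symmetric]; use assms in simp)
  qed
qed

text \<open>Tannery's theorem: the terms converge individually, and \<open>F_term_bound\<close>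
  majorises them uniformly for small \<open>\<epsilon>\<close>.\<close>

lemma F_eps_tendsto_F_zero:
  assumes "Re s > 2"
  shows "F_term v (\<lambda>_. u) s summable_on Sq_odd"
    "((\<lambda>\<epsilon>. F_eps \<epsilon> v u s) \<longlongrightarrow> F_zero v u s) (at_right 0)"
proof -
  \<comment> \<open>With \<open>Re s = 2 + 2 * \<eta>\<close> and
    \<open>\<epsilon> \<le> 2 * \<eta>\<close>, the exponent
    \<open>1 + \<epsilon> / 2 - Re s\<close> is at most \<open>-1 - \<eta>\<close>, which is
    summable.\<close>
  define \<eta> where "\<eta> = (Re s - 2) / 2"
  have "\<eta> > 0" using assms by (simp add: \<eta>_def)
  obtain C where C: "C \<ge> 0" "\<And>\<epsilon> Q s. \<epsilon> \<ge> 0 \<Longrightarrow> Q > 0 \<Longrightarrow>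
       norm (F_term v (rescale \<epsilon> u) s Q) \<le> C * real Q powr (1 + \<epsilon> / 2 - Re s)"
    by (rule F_term_bound) blast
  \<comment> \<open>Extension by zero turns the sum over \<open>Sq_odd\<close> into a series over
    the naturals, the setting of Tannery's theorem.\<close>
  define a where "a = (\<lambda>Q \<epsilon>. if Q \<in> Sq_odd then F_term v (rescale \<epsilon> u) s Q else 0)"
  define b where "b = (\<lambda>Q. if Q \<in> Sq_odd then F_term v (\<lambda>_. u) s Q else 0)"
  define M where "M = (\<lambda>Q::nat. C * real Q powr (-1 - \<eta>))"
  have pos: "Q > 0" if "Q \<in> Sq_odd" for Q using that by (simp add: Sq_odd_def)
  have "summable M"
    unfolding M_def using \<open>\<eta> > 0\<close> by (intro summable_mult) (simp add: summable_real_powr_iff)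
  have bound: "norm (a Q \<epsilon>) \<le> M Q" if "0 \<le> \<epsilon>" "\<epsilon> \<le> 2 * \<eta>" for Q \<epsilon>
  proof (cases "Q \<in> Sq_odd")
    case True
    then have "norm (a Q \<epsilon>) \<le> C * real Q powr (1 + \<epsilon> / 2 - Re s)"
      using C(2)[OF that(1) pos] by (simp add: a_def)
    also have "\<dots> \<le> M Q"
      unfolding M_def using pos[OF True] that C(1)
      by (intro mult_left_mono powr_mono) (auto simp: \<eta>_def field_simps)
    finally show ?thesis .
  qed (simp add: a_def M_def C)
  have b0: "b Q = a Q 0" for Q
    using pos by (simp add: a_def b_def F_term_v_u_eq)
  have a_sum: "(\<lambda>Q. F_term v (rescale \<epsilon> u) s Q) summable_on Sq_odd \<and>
     (\<Sum>\<^sub>\<infinity>Q\<in>Sq_odd. F_term v (rescale \<epsilon> u) s Q) = (\<Sum>Q. a Q \<epsilon>)" if "0 \<le> \<epsilon>" "\<epsilon> \<le> 2 * \<eta>" for \<epsilon>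
  proof -
    have norm: "summable (\<lambda>Q. norm (a Q \<epsilon>))"
      by (rule summable_comparison_test'[OF \<open>summable M\<close>, of 0]) (simp add: bound that)
    have "((\<lambda>Q. a Q \<epsilon>) has_sum (\<Sum>Q. a Q \<epsilon>)) UNIV"
      by (rule norm_summable_imp_has_sum[OF norm summable_sums[OF summable_norm_cancel[OF norm]]])
    also have "?this \<longleftrightarrow> ((\<lambda>Q. F_term v (rescale \<epsilon> u) s Q) has_sum (\<Sum>Q. a Q \<epsilon>)) Sq_odd"
      by (rule has_sum_cong_neutral) (auto simp: a_def)
    finally show ?thesis by (simp add: has_sum_iff)
  qed
  have zero: "F_term v (\<lambda>_. u) s summable_on Sq_odd \<longleftrightarrow> F_term v (rescale 0 u) s summable_on Sq_odd"
    "F_zero v u s = (\<Sum>\<^sub>\<infinity>Q\<in>Sq_odd. F_term v (rescale 0 u) s Q)"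
    unfolding F_zero_def
    by (auto intro!: summable_on_cong infsum_cong simp: F_term_v_u_eq pos)
  then show "F_term v (\<lambda>_. u) s summable_on Sq_odd"
    using a_sum[of 0] \<open>\<eta> > 0\<close> by simp
  have "((\<lambda>\<epsilon>. \<Sum>Q. a Q \<epsilon>) \<longlongrightarrow> (\<Sum>Q. b Q)) (at_right 0)"
  proof (rule tannerys_theorem[THEN conjunct2, THEN conjunct2])
    show "((\<lambda>\<epsilon>. a Q \<epsilon>) \<longlongrightarrow> b Q) (at_right 0)" for Q
      unfolding a_def b_def using tendsto_F_term[OF pos] by auto
    have "\<forall>\<^sub>F \<epsilon> in at_right 0. 0 \<le> \<epsilon> \<and> \<epsilon> \<le> 2 * \<eta>"
      using \<open>\<eta> > 0\<close> by (intro eventually_at_rightI[of 0 "2 * \<eta>"]) auto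
    then show "\<forall>\<^sub>F (Q, \<epsilon>) in sequentially \<times>\<^sub>F at_right 0. norm (a Q \<epsilon>) \<le> M Q"
      unfolding eventually_prod_filter
      by (intro exI[of _ "\<lambda>_. True"] exI[of _ "\<lambda>\<epsilon>. 0 \<le> \<epsilon> \<and> \<epsilon> \<le> 2 * \<eta>"]) (auto intro: bound)
  qed (use \<open>summable M\<close> in auto)
  also have "(\<Sum>Q. b Q) = F_zero v u s"
    using a_sum[of 0] \<open>\<eta> > 0\<close> by (simp add: zero b0)
  finally show "((\<lambda>\<epsilon>. F_eps \<epsilon> v u s) \<longlongrightarrow> F_zero v u s) (at_right 0)"
  proof (rule Lim_transform_eventually)
    have "\<forall>\<^sub>F \<epsilon> in at_right 0. 0 \<le> \<epsilon> \<and> \<epsilon> \<le> 2 * \<eta>"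
      using \<open>\<eta> > 0\<close> by (intro eventually_at_rightI[of 0 "2 * \<eta>"]) auto
    then show "\<forall>\<^sub>F \<epsilon> in at_right 0. (\<Sum>Q. a Q \<epsilon>) = F_eps \<epsilon> v u s"
      by eventually_elim (simp add: F_eps_def a_sum)
  qed
qed

end

text \<open>Summability is asserted beside each claim because \<open>infsum\<close> is 0 on families
  that are not summable.\<close>

theorem theorem9p2:
  fixes v u :: "real \<Rightarrow> complex"
  assumes "smooth v" and "smooth u"
    and "supp v \<subseteq> {1..2 powr (3/2)}"
    and "\<And>x. u (- x) = u x" and "supp u \<subseteq> {-1..1}"
    and "\<And>j. vderiv j u 0 = 0" and "\<And>j. vderiv j v 2 = 0"
  shows "(\<forall>\<epsilon>>0. (\<forall>s. F_term v (rescale \<epsilon> u) s summable_on Sq_odd) \<and>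
                 F_eps \<epsilon> v u holomorphic_on UNIV) \<and>
         (\<forall>s. Re s > 2 \<longrightarrow> F_term v (\<lambda>_. u) s summable_on Sq_odd \<and>
                 ((\<lambda>\<epsilon>. F_eps \<epsilon> v u s) \<longlongrightarrow> F_zero v u s) (at_right 0))"
proof (intro conjI allI impI)
  fix \<epsilon> :: real and s assume "\<epsilon> > 0"
  then show "F_term v (rescale \<epsilon> u) s summable_on Sq_odd"
    by (intro F_eps_summable_and_entire assms)
next
  fix \<epsilon> :: real assume "\<epsilon> > 0"
  then show "F_eps \<epsilon> v u holomorphic_on UNIV"
    by (intro F_eps_summable_and_entire assms)
next
  fix s :: complex assume "Re s > 2"
  then show "F_term v (\<lambda>_. u) s summable_on Sq_odd"
    "((\<lambda>\<epsilon>. F_eps \<epsilon> v u s) \<longlongrightarrow> F_zero v u s) (at_right 0)"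
    by (intro F_eps_tendsto_F_zero assms; simp)+
qed

end
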